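(* Let $f:\mathbb{R}^{n+m}\to\mathbb{R}$ be a $C^2$ function such that $\nabla f$ is globally Lipschitz with constant $L>0$ and $\nabla^2 f(z^\ast)$ is invertible at every saddle point $z^\ast$ of $f$. Let $\tau>0$ and, for a saddle point $z^\ast$ of $f$, define $$M=M(z^\ast)=\begin{cases}\dfrac{\big|\max_{\lambda\in\sigma(\Lambda_\tau H(z^\ast))}\Re(\lambda)\big|}{\max\{L^2,L^2/\tau^2\}}&\text{if }\max_{\lambda\in\sigma(\Lambda_\tau H(z^\ast))}\Re(\lambda)<0,\\[2mm]\infty&\text{if }\max_{\lambda\in\sigma(\Lambda_\tau H(z^\ast))}\Re(\lambda)=0.\end{cases}$$ (i) Consider the ODE $\dot z=-\Lambda_\tau F(z)$. The set of saddle points of $f$ is a subset of the set of exponentially stable equilibria of this ODE if, for every saddle point $z^\ast$, $\Re(\lambda)\ne0$ for all $\lambda\in\sigma(\Lambda_\tau H(z^\ast))$. (ii) Consider the ODE $\dot z=\big(-I+\tfrac{s}{2}\Lambda_\tau\nabla F(z)\big)\Lambda_\tau F(z)$. The set of saddle points of $f$ is a subset of the set of exponentially stable equilibria of this ODE if, for every saddle point $z^\ast$, $0<s<2\min\{M(z^\ast),\min\{L^{-1},\tfrac{\tau}{L}\}\}$.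
   Context: Write $z=(x,y)\in\mathbb{R}^n\times\mathbb{R}^m$. A (local) saddle point of $f$ is a point $(x^\ast,y^\ast)$ having a neighbourhood $U$ such that $f(x^\ast,y)\le f(x^\ast,y^\ast)\le f(x,y^\ast)$ for all $(x,y)\in U$. Notation: $F(z)=\begin{bmatrix}\nabla_x f(z)\\-\nabla_y f(z)\end{bmatrix}$, $\nabla F$ is the Jacobian matrix of $F$, $H(z)=-\nabla F(z)=\begin{bmatrix}-\nabla^2_{xx}f(z)&-\nabla^2_{xy}f(z)\\ \nabla^2_{yx}f(z)&\nabla^2_{yy}f(z)\end{bmatrix}$, $\Lambda_\tau=\begin{bmatrix}\frac1\tau I&0\\0&I\end{bmatrix}$ (blocks of sizes $n$ and $m$); $\sigma(\cdot)$ is the spectrum. (It is known that all eigenvalues of $\Lambda_\tau H(z^\ast)$ at a saddle point $z^\ast$ have nonpositive real part, so $M$ is well defined.) An equilibrium $Z^e$ of an ODE is exponentially stable (meant locally) if it is stable (for every $\varepsilon>0$ there is $\delta>0$ such that $|Z(0)-Z^e|<\delta$ implies $|Z(t)-Z^e|<\varepsilon$ for all $t\ge0$) and there exist $\delta,M',\lambda>0$ such that $|Z(0)-Z^e|<\delta$ implies $|Z(t)-Z^e|\le M'e^{-\lambda t}|Z(0)-Z^e|$ for all $t\ge0$. (The ODEs in (i) and (ii) are the $O(1)$- and $O(s)$-resolution ODEs of the Two-Timescale Proximal Point iteration $z_{k+1}=z_k-s\Lambda_\tau F(z_{k+1})$.) *)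

theory Defs
  imports "HOL-Analysis.Analysis"
begin

text \<open>
  A point \<open>z = (x, y)\<close> of \<open>\<real>\<^sup>n \<times> \<real>\<^sup>m = \<real>\<^sup>n\<^sup>+\<^sup>m\<close> is a vector indexed by the sum type
  \<open>'n + 'm\<close>, so that all block matrices below are ordinary square matrices over that index type.
\<close>

definition join :: "real ^ ('n::finite) \<Rightarrow> real ^ ('m::finite) \<Rightarrow> real ^ ('n + 'm)" where
  "join x y = (\<chi> i. case i of Inl a \<Rightarrow> x $ a | Inr b \<Rightarrow> y $ b)"

definition xpart :: "real ^ ('n::finite + 'm::finite) \<Rightarrow> real ^ 'n" where
  "xpart z = (\<chi> a. z $ Inl a)"

definition ypart :: "real ^ ('n::finite + 'm::finite) \<Rightarrow> real ^ 'm" where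
  "ypart z = (\<chi> b. z $ Inr b)"

definition saddle_point :: "(real ^ ('n::finite + 'm::finite) \<Rightarrow> real) \<Rightarrow> real ^ ('n + 'm) \<Rightarrow> bool" where
  "saddle_point f zs \<longleftrightarrow>
     (\<exists>U. open U \<and> zs \<in> U \<and>
        (\<forall>x y. join x y \<in> U \<longrightarrow>
           f (join (xpart zs) y) \<le> f zs \<and> f zs \<le> f (join x (ypart zs))))"

definition grad :: "('a::real_inner \<Rightarrow> real) \<Rightarrow> 'a \<Rightarrow> 'a" where
  "grad f z = (THE D. GDERIV f z :> D)"

definition hessian :: "(real ^ ('k::finite) \<Rightarrow> real) \<Rightarrow> real ^ 'k \<Rightarrow> real ^ 'k ^ 'k" where
  "hessian f z = jacobian (grad f) (at z)"

definition C2 :: "(real ^ ('k::finite) \<Rightarrow> real) \<Rightarrow> bool" where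
  "C2 f \<longleftrightarrow> (\<forall>z. f differentiable (at z)) \<and> (\<forall>z. grad f differentiable (at z)) \<and>
     continuous_on UNIV (hessian f)"

definition saddle_F :: "(real ^ ('n::finite + 'm::finite) \<Rightarrow> real) \<Rightarrow> real ^ ('n + 'm) \<Rightarrow> real ^ ('n + 'm)" where
  "saddle_F f z = join (xpart (grad f z)) (- ypart (grad f z))"

definition saddle_H :: "(real ^ ('n::finite + 'm::finite) \<Rightarrow> real) \<Rightarrow> real ^ ('n + 'm) \<Rightarrow> real ^ ('n + 'm) ^ ('n + 'm)" where
  "saddle_H f z = - jacobian (saddle_F f) (at z)"

definition Lam :: "real \<Rightarrow> real ^ ('n::finite + 'm::finite) ^ ('n + 'm)" where
  "Lam \<tau> = (\<chi> i j. if i = j then (case i of Inl _ \<Rightarrow> 1 / \<tau> | Inr _ \<Rightarrow> 1) else 0)"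

definition spectrum :: "real ^ ('k::finite) ^ 'k \<Rightarrow> complex set" where
  "spectrum A = {\<mu>. \<exists>v. v \<noteq> 0 \<and> map_matrix complex_of_real A *v v = \<mu> *s v}"

definition max_Re :: "real ^ ('k::finite) ^ 'k \<Rightarrow> real" where
  "max_Re A = Max (Re ` spectrum A)"

text \<open>
  At a saddle point \<open>max_Re (Lam \<tau> ** saddle_H f zs) \<le> 0\<close>, so there the last branch is exactly the
  case of a vanishing maximum.
\<close>

definition M_bound :: "(real ^ ('n::finite + 'm::finite) \<Rightarrow> real) \<Rightarrow> real \<Rightarrow> real \<Rightarrow> real ^ ('n + 'm) \<Rightarrow> ereal" where
  "M_bound f L \<tau> zs =
     (if max_Re (Lam \<tau> ** saddle_H f zs) < 0
      then ereal (\<bar>max_Re (Lam \<tau> ** saddle_H f zs)\<bar> / max (L\<^sup>2) (L\<^sup>2 / \<tau>\<^sup>2))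
      else \<infinity>)"

definition ode_solution :: "('a::real_normed_vector \<Rightarrow> 'a) \<Rightarrow> real set \<Rightarrow> (real \<Rightarrow> 'a) \<Rightarrow> bool" where
  "ode_solution G J Z \<longleftrightarrow> (\<forall>t\<in>J. (Z has_vector_derivative G (Z t)) (at t within J))"

text \<open>
  Local exponential stability of an equilibrium of \<open>Z' = G Z\<close>. For a field that is merely
  continuous, solutions need be neither unique nor a priori global. Hence the estimates ``for all
  \<open>t \<ge> 0\<close>'' are required of every solution for as long as it is defined (a solution on
  \<open>[0, b)\<close> or \<open>[0, \<infinity>)\<close> restricts to one on every \<open>[0, T]\<close> inside its domain), and
  solutions for all \<open>t \<ge> 0\<close> are required to exist from all initial values near the equilibrium.
\<close>

definition forward_complete_near :: "('a::real_normed_vector \<Rightarrow> 'a) \<Rightarrow> 'a \<Rightarrow> bool" where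
  "forward_complete_near G e \<longleftrightarrow>
     (\<exists>\<delta>>0. \<forall>z. norm (z - e) < \<delta> \<longrightarrow> (\<exists>Z. ode_solution G {0..} Z \<and> Z 0 = z))"

definition stable :: "('a::real_normed_vector \<Rightarrow> 'a) \<Rightarrow> 'a \<Rightarrow> bool" where
  "stable G e \<longleftrightarrow>
     (\<forall>\<epsilon>>0. \<exists>\<delta>>0. \<forall>T\<ge>0. \<forall>Z. ode_solution G {0..T} Z \<and> norm (Z 0 - e) < \<delta> \<longrightarrow>
        (\<forall>t\<in>{0..T}. norm (Z t - e) < \<epsilon>))"

definition exp_attractive :: "('a::real_normed_vector \<Rightarrow> 'a) \<Rightarrow> 'a \<Rightarrow> bool" where
  "exp_attractive G e \<longleftrightarrow>
     (\<exists>\<delta>>0. \<exists>M'>0. \<exists>\<mu>>0. \<forall>T\<ge>0. \<forall>Z. ode_solution G {0..T} Z \<and> norm (Z 0 - e) < \<delta> \<longrightarrow>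
        (\<forall>t\<in>{0..T}. norm (Z t - e) \<le> M' * exp (- \<mu> * t) * norm (Z 0 - e)))"

definition exp_stable_equilibrium :: "('a::real_normed_vector \<Rightarrow> 'a) \<Rightarrow> 'a \<Rightarrow> bool" where
  "exp_stable_equilibrium G e \<longleftrightarrow>
     G e = 0 \<and> forward_complete_near G e \<and> stable G e \<and> exp_attractive G e"

definition field_O1 :: "(real ^ ('n::finite + 'm::finite) \<Rightarrow> real) \<Rightarrow> real \<Rightarrow> real ^ ('n + 'm) \<Rightarrow> real ^ ('n + 'm)" where
  "field_O1 f \<tau> z = - (Lam \<tau> *v saddle_F f z)"

definition field_Os :: "(real ^ ('n::finite + 'm::finite) \<Rightarrow> real) \<Rightarrow> real \<Rightarrow> real \<Rightarrow> real ^ ('n + 'm) \<Rightarrow> real ^ ('n + 'm)" where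
  "field_Os f \<tau> s z =
     (- mat 1 + (s / 2) *\<^sub>R (Lam \<tau> ** jacobian (saddle_F f) (at z))) *v (Lam \<tau> *v saddle_F f z)"

end

theory Submission
  imports
    Defs
    "HOL-Computational_Algebra.Fundamental_Theorem_Algebra"
    "HOL-Complex_Analysis.Great_Picard"
begin

text \<open>
  With \<open>D\<close> the Hessian of \<open>f\<close>, both fields are built from \<open>A = \<Lambda>\<^sub>\<tau> H = Lam (- \<tau>) ** D\<close>: their
  derivatives at a saddle point are \<open>A\<close> and \<open>A + (s/2) A\<^sup>2\<close>, the latter because \<open>\<nabla>F\<close> multiplies a factor
  that vanishes there and so need only be continuous. For the inner product weighted by
  \<open>\<Lambda>\<^sub>\<tau>\<^sup>-\<^sup>1\<close> the symmetric part of \<open>A\<close> is negative semidefinite, so every eigenvalue satisfies \<open>Re \<mu> \<le> 0\<close>;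
  moreover \<open>\<mu> \<noteq> 0\<close> and \<open>\<bar>\<mu>\<bar> \<le> max L (L/\<tau>)\<close>. The bounds on \<open>s\<close> then put \<open>\<mu> + (s/2) \<mu>\<^sup>2\<close> into the open left
  half-plane. Stability follows from linearisation with a quadratic Lyapunov function, and Peano's theorem
  supplies solutions, since the second field is merely continuous.
\<close>

section \<open>Lyapunov forms of Hurwitz matrices\<close>

text \<open>At a saddle point \<open>A\<close> itself need not be Hurwitz: purely imaginary
  eigenvalues are possible there. With \<open>r = s/2\<close>, the quadratic term moves an
  eigenvalue \<open>i b\<close> to \<open>i b - r b^2\<close>, which helps, but the same term can
  push an eigenvalue with a large real part to the right. Hence the two kinds of bound on
  \<open>s\<close>. If the largest real part is negative, \<open>M_bound\<close> balances it against
  \<open>r |\<mu>|^2\<close>; its denominator is the square of the norm bound for \<open>A\<close>.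
  If the largest real part vanishes, \<open>1/L\<close> and \<open>\<tau>/L\<close> ensure
  \<open>r |\<mu>| < 1\<close>, so that the linear term dominates whenever it is nonzero.

  The Lyapunov function comes from an annihilating polynomial of \<open>A\<close> all of whose roots
  are eigenvalues. Its linear factors are used up one at a time, and a repeated root simply occurs
  several times in the list.\<close>

definition poly_act :: "'a::field poly \<Rightarrow> 'a ^ 'k ^ 'k \<Rightarrow> 'a ^ 'k \<Rightarrow> 'a ^ ('k::finite)" where
  "poly_act p A v = fold_coeffs (\<lambda>a w. a *s v + A *v w) p 0"

lemma poly_act_0 [simp]: "poly_act 0 A v = 0"
  by (simp add: poly_act_def)

lemma poly_act_pCons [simp]: "poly_act (pCons a p) A v = a *s v + A *v poly_act p A v"
  by (cases "p = 0 \<and> a = 0") (auto simp: poly_act_def)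

lemma poly_act_add: "poly_act (p + q) A v = poly_act p A v + poly_act q A v"
  by (induction p q rule: poly_induct2) (simp_all add: vector_sadd_rdistrib matrix_vector_right_distrib)

lemma poly_act_smult: "poly_act (smult c p) A v = c *s poly_act p A v"
  by (induction p) (simp_all add: vector_add_ldistrib vector_smult_assoc vector_scalar_commute)

lemma poly_act_sum: "poly_act (\<Sum>i\<in>I. p i) A v = (\<Sum>i\<in>I. poly_act (p i) A v)"
  by (induction I rule: infinite_finite_induct) (simp_all add: poly_act_add)

lemma poly_act_linear_factor:
  "poly_act ([:- \<mu>, 1:] * q) A v = A *v poly_act q A v - \<mu> *s poly_act q A v"
proof -
  have "[:- \<mu>, 1:] * q = smult (- \<mu>) q + pCons 0 q" by simp
  then show ?thesis
    by (simp only: poly_act_add poly_act_smult poly_act_pCons) (simp add: vec_eq_iff)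
qed

lemma poly_act_monom: "poly_act (monom c i) A v = c *s ((((**) A) ^^ i) (mat 1) *v v)"
  by (induction i)
     (simp_all add: monom_0 monom_Suc vector_scalar_commute flip: matrix_vector_mul_assoc)

lemma poly_act_eigenvector:
  assumes "A *v v = \<mu> *s v"
  shows "poly_act p A v = poly p \<mu> *s v"
  by (induction p) (simp_all add: assms vector_sadd_rdistrib vector_scalar_commute vector_smult_assoc mult.commute)

text \<open>The dependence is indexed by position, because the sequence may repeat a value. A
  repetition is itself a dependence, with coefficients 1 and -1; otherwise the first
  \<open>DIM('a) + 1\<close> terms are too many to be independent.\<close>

lemma sequence_linearly_dependent:
  fixes m :: "nat \<Rightarrow> 'a::euclidean_space"
  obtains N c where "\<exists>i\<le>N. c i \<noteq> 0" "(\<Sum>i\<le>N. c i *\<^sub>R m i) = 0"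
proof (cases "inj_on m {..DIM('a)}")
  case True
  then have "dependent (m ` {..DIM('a)})"
    by (intro dependent_biggerset) (auto simp: card_image)
  then obtain u v where u: "v \<in> m ` {..DIM('a)}" "u v \<noteq> 0" "(\<Sum>v\<in>m ` {..DIM('a)}. u v *\<^sub>R v) = 0"
    unfolding real_vector.dependent_finite[OF finite_imageI[OF finite_atMost]] by blast
  show ?thesis
    by (rule that[of "DIM('a)" "u \<circ> m"]) (use u True in \<open>auto simp: sum.reindex\<close>)
next
  case False
  then obtain i j where ij: "i \<le> DIM('a)" "j \<le> DIM('a)" "i \<noteq> j" "m i = m j"
    by (auto simp: inj_on_def)
  let ?c = "\<lambda>k. (if k = i then 1 else 0) - (if k = j then 1 else 0) :: real"
  have "(\<Sum>k\<le>DIM('a). ?c k *\<^sub>R m k)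
      = (\<Sum>k\<le>DIM('a). (if k = i then m k else 0) - (if k = j then m k else 0))"
    by (rule sum.cong) auto
  also have "\<dots> = 0"
    using ij by (simp add: sum_subtractf)
  finally show ?thesis
    using ij by (intro that[of "DIM('a)" ?c]) auto
qed

text \<open>The powers of \<open>A\<close> lie in a finite-dimensional real space, so a non-trivial
  real combination of them vanishes. Its coefficients are those of the polynomial.\<close>

lemma annihilating_poly_exists:
  fixes A :: "complex ^ 'k ^ ('k::finite)"
  obtains p where "p \<noteq> 0" "\<And>v. poly_act p A v = 0"
proof -
  define m where "m i = (((**) A) ^^ i) (mat 1)" for i
  obtain N c where c: "\<exists>i\<le>N. c i \<noteq> 0" "(\<Sum>i\<le>N. c i *\<^sub>R m i) = 0"
    by (rule sequence_linearly_dependent)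
  define p where "p = (\<Sum>i\<le>N. monom (complex_of_real (c i)) i)"
  have coeff: "coeff p i = of_real (c i)" if "i \<le> N" for i
    using that by (simp add: p_def coeff_sum)
  have "poly_act p A v = 0" for v
  proof -
    have "poly_act p A v = (\<Sum>i\<le>N. complex_of_real (c i) *s (m i *v v))"
      by (simp add: p_def poly_act_sum poly_act_monom m_def)
    also have "\<dots> = (\<Sum>i\<le>N. (c i *\<^sub>R m i) *v v)"
      by (rule sum.cong)
         (auto simp: vec_eq_iff matrix_vector_mult_def sum_distrib_left scaleR_conv_of_real[where 'a=complex] mult.assoc)
    also have "\<dots> = (\<Sum>i\<le>N. c i *\<^sub>R m i) *v v"
      by (simp add: vec_eq_iff matrix_vector_mult_def sum_distrib_right)
         (intro allI sum.swap)
    finally show ?thesis by (simp add: c)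
  qed
  moreover have "p \<noteq> 0"
    using c(1) coeff by fastforce
  ultimately show ?thesis using that by blast
qed

text \<open>This is the product of the maps \<open>A - \<mu>\<close> over the list, the head acting
  last. Keeping a list gives an induction that adds one factor at a time.\<close>

definition factors_act :: "complex ^ 'k ^ 'k \<Rightarrow> complex list \<Rightarrow> complex ^ 'k \<Rightarrow> complex ^ ('k::finite)" where
  "factors_act A \<mu>s v = foldr (\<lambda>\<mu> w. A *v w - \<mu> *s w) \<mu>s v"

lemma factors_act_simps [simp]:
  "factors_act A [] v = v"
  "factors_act A (\<mu> # \<mu>s) v = A *v factors_act A \<mu>s v - \<mu> *s factors_act A \<mu>s v"
  by (simp_all add: factors_act_def)

lemma poly_act_prod_list: "poly_act (\<Prod>\<mu>\<leftarrow>\<mu>s. [:- \<mu>, 1:]) A v = factors_act A \<mu>s v"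
  by (induction \<mu>s) (simp_all add: poly_act_linear_factor one_pCons del: mult_pCons_left)

lemma factors_act_commute: "factors_act A \<mu>s (A *v v) = A *v factors_act A \<mu>s v"
  by (induction \<mu>s) (simp_all add: matrix_vector_mult_diff_distrib vector_scalar_commute)

lemma scaleR_eq_vector_smult: "c *\<^sub>R (v :: complex ^ 'k) = complex_of_real c *s v"
  by (simp add: vec_eq_iff scaleR_conv_of_real[where 'a=complex])

lemma bounded_linear_complex_matrix: "bounded_linear ((*v) (A :: complex ^ 'n::finite ^ 'k::finite))"
  by (intro linear_conv_bounded_linear[THEN iffD1] linearI)
     (simp_all add: matrix_vector_right_distrib scaleR_eq_vector_smult vector_scalar_commute)

lemma bounded_linear_vector_smult: "bounded_linear (\<lambda>v :: complex ^ 'k::finite. \<mu> *s v)"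
  by (intro linear_conv_bounded_linear[THEN iffD1] linearI)
     (simp_all add: vector_add_ldistrib scaleR_eq_vector_smult vector_smult_assoc mult.commute)

lemma bounded_linear_factors_act: "bounded_linear (factors_act A \<mu>s)"
proof (induction \<mu>s)
  case Nil
  then show ?case by (simp add: factors_act_def bounded_linear_ident)
next
  case (Cons \<mu> \<mu>s)
  have "bounded_linear (\<lambda>v. A *v factors_act A \<mu>s v - \<mu> *s factors_act A \<mu>s v)"
    by (intro bounded_linear_sub
        bounded_linear_compose[OF bounded_linear_complex_matrix Cons.IH]
        bounded_linear_compose[OF bounded_linear_vector_smult Cons.IH])
  moreover have "factors_act A (\<mu> # \<mu>s) = (\<lambda>v. A *v factors_act A \<mu>s v - \<mu> *s factors_act A \<mu>s v)"
    by (simp add: fun_eq_iff)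
  ultimately show ?case by simp
qed

text \<open>The inner product on \<open>complex ^ 'k\<close> is the real part of the Hermitian one,
  so multiplication by \<open>i\<close> is skew and only the real part of the scalar
  survives.\<close>

lemma inner_vector_smult_self:
  fixes v :: "complex ^ 'k::finite"
  shows "v \<bullet> (\<mu> *s v) = Re \<mu> * (norm v)\<^sup>2"
proof -
  have *: "z \<bullet> (\<mu> * z) = Re \<mu> * (z \<bullet> z)" for z :: complex
    by (simp add: inner_complex_def algebra_simps)
  show ?thesis
    by (simp add: power2_norm_eq_inner inner_vec_def sum_distrib_left *)
qed

text \<open>The coercivity constant can be normalised to 1 because the construction starts from
  \<open>inner\<close> and only adds nonnegative squares.\<close>

definition lyapunov_form :: "('a::real_normed_vector \<Rightarrow> 'a \<Rightarrow> real) \<Rightarrow> bool" where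
  "lyapunov_form Q \<longleftrightarrow> bounded_bilinear Q \<and> (\<forall>x y. Q x y = Q y x) \<and> (\<forall>x. (norm x)\<^sup>2 \<le> Q x x)"

text \<open>
  The term \<open>norm (factors_act A \<mu>s x)\<close> is the defect that every further factor lets one push one step
  down the chain: the square of \<open>w = factors_act A \<mu>s x\<close> decays at rate \<open>2 Re \<mu>\<close> up to an
  error controlled by \<open>A *v w - \<mu> *s w\<close>. Once the product of the factors vanishes, no defect is left.
\<close>

lemma lyapunov_form_up_to_defect:
  fixes A :: "complex ^ 'k ^ ('k::finite)"
  assumes "\<And>\<mu>. \<mu> \<in> set \<mu>s \<Longrightarrow> Re \<mu> < 0"
  shows "\<exists>Q c C. lyapunov_form Q \<and> c > 0 \<and> C \<ge> 0 \<and>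
    (\<forall>x. Q x (A *v x) \<le> - c * (norm x)\<^sup>2 + C * (norm (factors_act A \<mu>s x))\<^sup>2)"
  using assms
proof (induction \<mu>s)
  case Nil
  obtain K where K: "K \<ge> 0" "\<And>x. norm (A *v x) \<le> norm x * K"
    using bounded_linear.nonneg_bounded[OF bounded_linear_complex_matrix] by blast
  \<comment> \<open>Without factors the defect is \<open>x\<close> itself, so a large multiple of it
    outweighs any growth caused by \<open>A\<close>.\<close>
  have "x \<bullet> (A *v x) \<le> - 1 * (norm x)\<^sup>2 + (K + 1) * (norm (factors_act A [] x))\<^sup>2" for x
  proof -
    have "x \<bullet> (A *v x) \<le> norm x * norm (A *v x)" by (rule norm_cauchy_schwarz)
    also have "\<dots> \<le> norm x * (norm x * K)" by (intro mult_left_mono K) auto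
    finally show ?thesis by (simp add: algebra_simps power2_eq_square)
  qed
  moreover have "lyapunov_form (inner :: complex ^ 'k \<Rightarrow> _)"
    by (simp add: lyapunov_form_def bounded_bilinear_inner inner_commute power2_norm_eq_inner)
  ultimately show ?case
    using K(1) by (intro exI[of _ inner] exI[of _ 1] exI[of _ "K + 1"]) auto
next
  case (Cons \<mu> \<mu>s)
  then obtain Q c C where Q: "lyapunov_form Q" "c > 0" "C \<ge> 0"
    "\<And>x. Q x (A *v x) \<le> - c * (norm x)\<^sup>2 + C * (norm (factors_act A \<mu>s x))\<^sup>2"
    by auto
  define \<eta> where "\<eta> = - Re \<mu>"
  have \<eta>: "\<eta> > 0" using Cons.prems by (simp add: \<eta>_def)
  \<comment> \<open>Chosen so that the decay \<open>N * \<eta> / 2\<close> retained by the new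
    square equals \<open>C\<close> and absorbs the old defect.\<close>
  define N where "N = 2 * C / \<eta>"
  have N: "N \<ge> 0" "C = N * \<eta> / 2" using \<eta> Q(3) by (auto simp: N_def)
  let ?P = "factors_act A \<mu>s"
  interpret Q: bounded_bilinear Q using Q(1) by (simp add: lyapunov_form_def)
  interpret P: bounded_linear ?P by (rule bounded_linear_factors_act)
  define Q' where "Q' x y = Q x y + N * (?P x \<bullet> ?P y)" for x y
  have "bounded_bilinear Q'"
    unfolding bilinear_conv_bounded_bilinear[symmetric] bilinear_def Q'_def
    by (auto intro!: linearI simp: Q.add_left Q.add_right Q.scaleR_left Q.scaleR_right
        P.add P.scaleR inner_add_left inner_add_right algebra_simps)
  moreover have "(norm x)\<^sup>2 \<le> Q' x x" for x
    using Q(1) N by (simp add: Q'_def lyapunov_form_def add_increasing2)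
  ultimately have "lyapunov_form Q'"
    using Q(1) by (simp add: lyapunov_form_def Q'_def inner_commute)
  moreover have "Q' x (A *v x) \<le> - c * (norm x)\<^sup>2 + N / (2 * \<eta>) * (norm (factors_act A (\<mu> # \<mu>s) x))\<^sup>2" for x
  proof -
    define w where "w = ?P x"
    define d where "d = A *v w - \<mu> *s w"
    have "w \<bullet> (A *v w) = w \<bullet> (\<mu> *s w) + w \<bullet> d"
      by (simp add: d_def inner_diff_right)
    also have "w \<bullet> d \<le> norm w * norm d" by (rule norm_cauchy_schwarz)
    \<comment> \<open>Young's inequality with weight \<eta>: half of the decay of \<open>w\<close>
      is spent on the mixed term, half survives.\<close>
    also have "norm w * norm d \<le> \<eta> / 2 * (norm w)\<^sup>2 + (norm d)\<^sup>2 / (2 * \<eta>)"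
    proof -
      have "0 \<le> (\<eta> * norm w - norm d)\<^sup>2" by simp
      then have "2 * \<eta> * (norm w * norm d) \<le> \<eta>\<^sup>2 * (norm w)\<^sup>2 + (norm d)\<^sup>2"
        by (simp add: power2_diff power_mult_distrib algebra_simps)
      then show ?thesis using \<eta> by (simp add: field_simps power2_eq_square)
    qed
    finally have "w \<bullet> (A *v w) \<le> - (\<eta> / 2) * (norm w)\<^sup>2 + (norm d)\<^sup>2 / (2 * \<eta>)"
      by (simp add: inner_vector_smult_self \<eta>_def algebra_simps)
    then have "N * (w \<bullet> (A *v w)) \<le> N * (- (\<eta> / 2) * (norm w)\<^sup>2 + (norm d)\<^sup>2 / (2 * \<eta>))"
      using N by (intro mult_left_mono)
    also have "\<dots> = - C * (norm w)\<^sup>2 + N / (2 * \<eta>) * (norm d)\<^sup>2"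
      by (subst N(2)) (simp add: algebra_simps)
    finally show ?thesis
      using Q(4)[of x] by (simp add: Q'_def factors_act_commute w_def d_def)
  qed
  ultimately show ?case
    using Q(2) N(1) \<eta> by (intro exI[of _ Q'] exI[of _ c] exI[of _ "N / (2 * \<eta>)"]) auto
qed

text \<open>In an annihilating polynomial of least degree every root \<mu> is an eigenvalue: the
  quotient \<open>q\<close> by the factor of \<mu> does not annihilate, and any nonzero
  \<open>poly_act q A v\<close> is an eigenvector. Over the complex numbers such a polynomial splits
  into linear factors.\<close>

lemma annihilating_eigenvalues_exist:
  fixes A :: "complex ^ 'k ^ ('k::finite)"
  obtains \<mu>s where "\<And>\<mu>. \<mu> \<in> set \<mu>s \<Longrightarrow> \<exists>v. v \<noteq> 0 \<and> A *v v = \<mu> *s v" "\<And>v. factors_act A \<mu>s v = 0"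
proof -
  define annih where "annih p \<longleftrightarrow> p \<noteq> 0 \<and> (\<forall>v. poly_act p A v = 0)" for p
  have "\<exists>p. annih p" using annihilating_poly_exists[of A] by (metis annih_def)
  then obtain p where p: "annih p" and least: "\<And>q. annih q \<Longrightarrow> degree p \<le> degree q"
    using ex_has_least_nat[of annih _ degree] by blast
  have root: "\<exists>v. v \<noteq> 0 \<and> A *v v = \<mu> *s v" if "poly p \<mu> = 0" for \<mu>
  proof -
    have "[:- \<mu>, 1:] dvd p" using that by (simp only: poly_eq_0_iff_dvd)
    then obtain q where q: "p = [:- \<mu>, 1:] * q" by (rule dvdE)
    have "q \<noteq> 0" using p q by (auto simp: annih_def)
    then have "degree q < degree p" by (simp add: q degree_mult_eq del: mult_pCons_left)
    then obtain v where "poly_act q A v \<noteq> 0"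
      using least[of q] \<open>q \<noteq> 0\<close> by (auto simp: annih_def)
    moreover have "A *v poly_act q A v - \<mu> *s poly_act q A v = 0"
      using p poly_act_linear_factor[of \<mu> q A v, folded q] by (simp add: annih_def)
    ultimately show ?thesis by auto
  qed
  obtain M where M: "p = smult (lead_coeff p) (\<Prod>x\<in>#M. [:- x, 1:])"
    using alg_closed_imp_factorization p by (auto simp: annih_def)
  obtain \<mu>s where \<mu>s: "mset \<mu>s = M" using ex_mset by blast
  have prod: "p = smult (lead_coeff p) (\<Prod>\<mu>\<leftarrow>\<mu>s. [:- \<mu>, 1:])"
    using M by (simp flip: \<mu>s prod_mset_prod_list)
  have "\<exists>v. v \<noteq> 0 \<and> A *v v = \<mu> *s v" if "\<mu> \<in> set \<mu>s" for \<mu>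
  proof (rule root)
    have "poly (\<Prod>\<mu>\<leftarrow>\<mu>s. [:- \<mu>, 1:]) \<mu> = 0"
      using that by (induction \<mu>s) auto
    then show "poly p \<mu> = 0" by (subst prod) simp
  qed
  moreover have "factors_act A \<mu>s v = 0" for v
  proof -
    have "lead_coeff p *s factors_act A \<mu>s v = poly_act p A v"
      by (subst (2) prod) (simp add: poly_act_smult poly_act_prod_list)
    then show ?thesis using p by (auto simp: annih_def)
  qed
  ultimately show ?thesis using that by blast
qed

section \<open>Complexification and the spectrum of real matrices\<close>

definition cvec :: "real ^ 'k \<Rightarrow> complex ^ ('k::finite)" where
  "cvec x = (\<chi> i. complex_of_real (x $ i))"

lemma norm_cvec [simp]: "norm (cvec x) = norm x"
  by (simp add: cvec_def norm_vec_def)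

lemma bounded_linear_cvec: "bounded_linear cvec"
  by (intro linear_conv_bounded_linear[THEN iffD1] linearI)
     (simp_all add: cvec_def vec_eq_iff complex_eq_iff)

lemma map_matrix_mult_cvec: "map_matrix complex_of_real A *v cvec x = cvec (A *v x)"
  by (simp add: cvec_def vec_eq_iff matrix_vector_mult_def)

text \<open>The embedding \<open>cvec\<close> is isometric and intertwines \<open>A\<close> with its
  complexification, so a complex Lyapunov form pulls back to a real one with the same
  constant.\<close>

lemma hurwitz_lyapunov_form:
  fixes A :: "real ^ 'k ^ ('k::finite)"
  assumes "\<And>\<mu>. \<mu> \<in> spectrum A \<Longrightarrow> Re \<mu> < 0"
  obtains Q c where "lyapunov_form Q" "c > 0" "\<And>x. Q x (A *v x) \<le> - c * (norm x)\<^sup>2"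
proof -
  let ?A = "map_matrix complex_of_real A"
  obtain \<mu>s where \<mu>s: "\<And>\<mu>. \<mu> \<in> set \<mu>s \<Longrightarrow> \<exists>v. v \<noteq> 0 \<and> ?A *v v = \<mu> *s v"
    "\<And>v. factors_act ?A \<mu>s v = 0"
    by (rule annihilating_eigenvalues_exist) blast
  have "Re \<mu> < 0" if "\<mu> \<in> set \<mu>s" for \<mu>
    using assms \<mu>s(1)[OF that] by (auto simp: spectrum_def)
  then obtain Q c where Q: "lyapunov_form Q" "c > 0" "\<And>x. Q x (?A *v x) \<le> - c * (norm x)\<^sup>2"
    using lyapunov_form_up_to_defect[of \<mu>s ?A] \<mu>s(2) by auto
  have "lyapunov_form (\<lambda>x y. Q (cvec x) (cvec y))"
    using Q(1) bounded_bilinear.comp[OF _ bounded_linear_cvec bounded_linear_cvec, of Q]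
    unfolding lyapunov_form_def by (auto simp flip: norm_cvec)
  moreover have "Q (cvec x) (cvec (A *v x)) \<le> - c * (norm x)\<^sup>2" for x
    using Q(3)[of "cvec x"] by (simp add: map_matrix_mult_cvec)
  ultimately show ?thesis using that Q(2) by blast
qed

text \<open>Every eigenvalue is a root of an annihilating polynomial. Finiteness is what gives the
  \<open>Max\<close> in \<open>max_Re\<close> its meaning.\<close>

lemma finite_spectrum: "finite (spectrum A)"
proof -
  let ?A = "map_matrix complex_of_real A"
  obtain p where p: "p \<noteq> 0" "\<And>v. poly_act p ?A v = 0"
    using annihilating_poly_exists by blast
  have "spectrum A \<subseteq> {\<mu>. poly p \<mu> = 0}"
  proof
    fix \<mu> assume "\<mu> \<in> spectrum A"
    then obtain v where "v \<noteq> 0" "?A *v v = \<mu> *s v"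
      by (auto simp: spectrum_def)
    then show "\<mu> \<in> {\<mu>. poly p \<mu> = 0}"
      using p(2) poly_act_eigenvector[of ?A v \<mu> p] by simp
  qed
  then show ?thesis using poly_roots_finite[OF p(1)] finite_subset by blast
qed

lemma Re_le_max_Re: "\<mu> \<in> spectrum A \<Longrightarrow> Re \<mu> \<le> max_Re A"
  unfolding max_Re_def by (intro Max_ge finite_imageI finite_spectrum) auto

text \<open>The vectors are the real and imaginary parts of a complex eigenvector; in this form real
  inner products can be applied to it.\<close>

lemma spectrum_real_pairs:
  assumes "\<mu> \<in> spectrum A"
  obtains x y where "x \<noteq> 0 \<or> y \<noteq> 0" "A *v x = Re \<mu> *\<^sub>R x - Im \<mu> *\<^sub>R y" "A *v y = Re \<mu> *\<^sub>R y + Im \<mu> *\<^sub>R x"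
proof -
  obtain v where v: "v \<noteq> 0" "map_matrix complex_of_real A *v v = \<mu> *s v"
    using assms by (auto simp: spectrum_def)
  let ?x = "\<chi> i. Re (v $ i)" and ?y = "\<chi> i. Im (v $ i)"
  have "(\<Sum>j\<in>UNIV. of_real (A $ i $ j) * v $ j) = \<mu> * v $ i" for i
    using v(2) by (simp add: vec_eq_iff matrix_vector_mult_def)
  from arg_cong[OF this, of Re] arg_cong[OF this, of Im]
  have "A *v ?x = Re \<mu> *\<^sub>R ?x - Im \<mu> *\<^sub>R ?y" "A *v ?y = Re \<mu> *\<^sub>R ?y + Im \<mu> *\<^sub>R ?x"
    by (simp_all add: vec_eq_iff matrix_vector_mult_def)
  moreover have "?x \<noteq> 0 \<or> ?y \<noteq> 0"
    using v(1) by (auto simp: vec_eq_iff complex_eq_iff)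
  ultimately show ?thesis using that by blast
qed

text \<open>
  If \<open>\<alpha>\<close>, \<open>\<beta>\<close> are the roots of \<open>r X\<^sup>2 + X - \<nu>\<close>, then \<open>r A\<^sup>2 + A - \<nu> = r (A - \<alpha>) (A - \<beta>)\<close>, so an
  eigenvector for \<open>\<nu>\<close> is either killed by \<open>A - \<beta>\<close> or mapped to an eigenvector for \<open>\<alpha>\<close>.
\<close>

lemma spectrum_quadratic:
  fixes A :: "real ^ 'k ^ ('k::finite)"
  assumes "\<nu> \<in> spectrum (A + r *\<^sub>R (A ** A))" "r \<noteq> 0"
  obtains \<mu> where "\<mu> \<in> spectrum A" "\<nu> = \<mu> + of_real r * \<mu>\<^sup>2"
proof -
  let ?A = "map_matrix complex_of_real A"
  let ?r = "complex_of_real r"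
  obtain v where v: "v \<noteq> 0" "map_matrix complex_of_real (A + r *\<^sub>R (A ** A)) *v v = \<nu> *s v"
    using assms(1) by (auto simp: spectrum_def)
  have "map_matrix complex_of_real (A ** A) = ?A ** ?A"
    by (simp add: vec_eq_iff matrix_matrix_mult_def)
  moreover have "map_matrix complex_of_real (A + r *\<^sub>R (A ** A)) *v v
      = ?A *v v + ?r *s (map_matrix complex_of_real (A ** A) *v v)"
    by (simp add: vec_eq_iff matrix_vector_mult_def sum.distrib distrib_right sum_distrib_left mult.assoc)
  ultimately have eq: "?A *v v + ?r *s (?A *v (?A *v v)) = \<nu> *s v"
    using v(2) by (simp add: matrix_vector_mul_assoc)
  \<comment> \<open>Quadratic formula for one root; the other is then fixed by the sum
    \<open>- 1 / r\<close> of the two roots.\<close>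
  define \<beta> where "\<beta> = (- 1 + csqrt (1 + 4 * ?r * \<nu>)) / (2 * ?r)"
  define \<alpha> where "\<alpha> = - 1 / ?r - \<beta>"
  have r: "?r \<noteq> 0" using assms(2) by simp
  have "2 * ?r * \<beta> + 1 = csqrt (1 + 4 * ?r * \<nu>)"
    using r by (simp add: \<beta>_def)
  then have "(2 * ?r * \<beta> + 1)\<^sup>2 = 1 + 4 * ?r * \<nu>"
    by simp
  then have "4 * ?r * (\<beta> + ?r * \<beta>\<^sup>2 - \<nu>) = 0"
    by (simp add: power2_eq_square algebra_simps)
  then have \<beta>: "\<nu> = \<beta> + ?r * \<beta>\<^sup>2" using r by simp
  then have \<alpha>: "\<nu> = \<alpha> + ?r * \<alpha>\<^sup>2" 
    using r by (simp add: \<alpha>_def power2_eq_square field_simps)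
  define w where "w = ?A *v v - \<beta> *s v"
  have "?r *s (?A *v w - \<alpha> *s w) = 0"
  proof -
    have "?r * (\<alpha> * \<beta>) = - \<nu>" "?r * (\<alpha> + \<beta>) = - 1"
      using r by (auto simp: \<alpha>_def \<beta> power2_eq_square field_simps)
    moreover have "?r *s (?A *v w - \<alpha> *s w)
        = ?r *s (?A *v (?A *v v)) - (?r * (\<alpha> + \<beta>)) *s (?A *v v) + (?r * (\<alpha> * \<beta>)) *s v"
      by (simp add: w_def vec_eq_iff matrix_vector_mult_diff_distrib vector_scalar_commute algebra_simps)
    ultimately show ?thesis
      using eq by (simp add: vec_eq_iff algebra_simps)
  qed
  then have w: "?A *v w = \<alpha> *s w" using r unfolding vector_mul_eq_0 by simp
  show ?thesis
  proof (cases "w = 0")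
    case True
    then have "\<beta> \<in> spectrum A" using v(1) by (auto simp: w_def spectrum_def)
    then show ?thesis using \<beta> that by blast
  next
    case False
    then have "\<alpha> \<in> spectrum A" using w by (auto simp: spectrum_def)
    then show ?thesis using \<alpha> that by blast
  qed
qed

section \<open>Peano existence\<close>

text \<open>Each Euler step differs from \<open>h g\<close> by at most \<open>h \<epsilon>\<close>,
  and these errors add up. It serves twice: \<open>g = 0\<close> and \<open>\<epsilon> = K\<close>
  give a Lipschitz bound, while \<open>g = G (Z t)\<close> controls the difference quotients of the
  limit.\<close>

lemma euler_increment_bound:
  fixes G :: "'a::real_normed_vector \<Rightarrow> 'a" and h :: real and z :: 'a
  defines "e \<equiv> \<lambda>j. ((\<lambda>x. x + h *\<^sub>R G x) ^^ j) z"
  assumes "h \<ge> 0" "i \<le> j" "\<And>k. i \<le> k \<Longrightarrow> k < j \<Longrightarrow> norm (G (e k) - g) \<le> \<epsilon>"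
  shows "norm (e j - e i - (real (j - i) * h) *\<^sub>R g) \<le> real (j - i) * h * \<epsilon>"
  using assms(3,4)
proof (induction j rule: dec_induct)
  case base
  then show ?case by simp
next
  case (step j)
  have "e (Suc j) - e i - (real (Suc j - i) * h) *\<^sub>R g
      = (e j - e i - (real (j - i) * h) *\<^sub>R g) + h *\<^sub>R (G (e j) - g)"
    using step.hyps by (simp add: e_def Suc_diff_le algebra_simps)
  also have "norm \<dots> \<le> real (j - i) * h * \<epsilon> + h * \<epsilon>"
    using step assms(2) by (intro norm_triangle_mono step.IH) (auto intro: mult_left_mono)
  finally show ?case
    using step.hyps by (simp add: Suc_diff_le algebra_simps)
qed

text \<open>Limit of Euler schemes with step \<open>h n\<close>. \<open>S n t\<close> is the value
  at the last grid point before \<open>t\<close>, a step function that is \<open>K\<close>-Lipschitz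
  up to the rounding error \<open>h n\<close>. A diagonal subsequence converges at all rational
  times, and the Lipschitz bound carries convergence to every \<open>t \<ge> 0\<close>. Since
  \<open>K\<close> is global, one limit covers the whole half-line.\<close>

theorem peano_existence_bounded:
  fixes G :: "'a::euclidean_space \<Rightarrow> 'a"
  assumes cont: "continuous_on UNIV G" and bound: "\<And>x. norm (G x) \<le> K"
  obtains Z where "ode_solution G {0..} Z" "Z 0 = z"
proof -
  have K: "K \<ge> 0" using bound[of 0] norm_ge_zero order_trans by blast
  define h where "h n = inverse (real (Suc n))" for n
  have h: "h n > 0" "h n \<le> 1" for n by (auto simp: h_def divide_simps)
  have h0: "h \<longlonglongrightarrow> 0" unfolding h_def by (rule LIMSEQ_inverse_real_of_nat)
  define e where "e n j = ((\<lambda>x. x + h n *\<^sub>R G x) ^^ j) z" for n j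
  define J where "J n t = nat \<lfloor>t / h n\<rfloor>" for n t
  define S where "S n t = e n (J n t)" for n t
  have J_mono: "J n a \<le> J n b" if "a \<le> b" for n a b
    unfolding J_def using that h(1)[of n] by (intro nat_mono floor_mono divide_right_mono) auto
  have J_approx: "real (J n t) * h n \<le> t" "t - h n \<le> real (J n t) * h n" if "t \<ge> 0" for n t
  proof -
    have r: "real (J n t) = of_int \<lfloor>t / h n\<rfloor>"
      unfolding J_def using that h(1)[of n] by (intro of_nat_nat) auto
    have "real (J n t) \<le> t / h n" "t / h n \<le> real (J n t) + 1"
      unfolding r by linarith+
    then show "real (J n t) * h n \<le> t" "t - h n \<le> real (J n t) * h n"
      using h(1)[of n] by (simp_all add: field_simps)
  qed
  have step_le: "real (J n b - J n a) * h n \<le> b - a + h n" if "0 \<le> a" "a \<le> b" for n a b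
    using J_approx[of a n] J_approx[of b n] J_mono[OF that(2), of n] that
    by (simp add: of_nat_diff algebra_simps)
  have e_bound: "norm (e n j - e n i) \<le> K * (real (j - i) * h n)" if "i \<le> j" for n i j
    using euler_increment_bound[of "h n" i j G z 0 K] h(1)[of n] that bound
    by (simp add: e_def mult_ac)
  have e_near: "norm (e n i - S n t) \<le> K * (b - a + h n)"
    if "0 \<le> a" "a \<le> b" "J n a \<le> i" "i \<le> J n b" "t \<in> {a..b}" for n i t a b
  proof -
    define p q where "p = min i (J n t)" and "q = max i (J n t)"
    have pq: "J n a \<le> p" "p \<le> q" "q \<le> J n b"
      using that J_mono[of a t n] J_mono[of t b n] by (auto simp: p_def q_def)
    have "norm (e n i - S n t) = norm (e n q - e n p)"
      by (auto simp: p_def q_def S_def min_def max_def norm_minus_commute)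
    also have "\<dots> \<le> K * (real (q - p) * h n)" by (rule e_bound[OF pq(2)])
    also have "\<dots> \<le> K * (real (J n b - J n a) * h n)"
      using pq K h(1)[of n] by (intro mult_left_mono mult_right_mono) auto
    also have "\<dots> \<le> K * (b - a + h n)"
      using step_le[OF that(1,2)] K by (intro mult_left_mono) auto
    finally show ?thesis .
  qed
  have S_lip: "norm (S n t - S n u) \<le> K * (\<bar>t - u\<bar> + h n)" if "0 \<le> t" "0 \<le> u" for n t u
  proof (cases "t \<le> u")
    case True
    have "K * h n \<ge> 0" using K h(1)[of n] by simp
    with True show ?thesis
      using e_near[of t u n "J n t" u] J_mono[OF True, of n] that by (simp add: S_def abs_if)
  next
    case False
    then show ?thesis
      using e_near[of u t n "J n t" u] J_mono[of u t n] that by (simp add: S_def abs_if)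
  qed
  have S_0: "S n 0 = z" for n by (simp add: S_def J_def e_def)
  \<comment> \<open>A time-dependent rescaling puts all schemes into the unit ball, the uniform
    bound under which the diagonal subsequence is extracted. It is undone in
    \<open>conv_rat\<close>.\<close>
  define \<phi> where "\<phi> n q = S n q /\<^sub>R (norm z + K * (q + 1) + 1)" for n q
  have pos: "norm z + K * (q + 1) + 1 > 0" if "q \<ge> 0" for q
    using K that by (intro add_nonneg_pos add_nonneg_nonneg mult_nonneg_nonneg) auto
  have \<phi>: "norm (\<phi> n q) \<le> 1" if "q \<in> \<rat> \<inter> {0..}" for n q
  proof -
    have "norm (S n q - z) \<le> K * (q + h n)"
      using S_lip[of q 0 n] that by (simp add: S_0)
    also have "\<dots> \<le> K * (q + 1)" using h(2) K by (intro mult_left_mono) auto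
    finally have "norm (S n q) \<le> norm z + K * (q + 1) + 1"
      using norm_triangle_ineq2[of "S n q" z] by linarith
    then show ?thesis using pos[of q] that by (simp add: \<phi>_def divide_simps)
  qed
  have "countable (\<rat> \<inter> {0::real..})" using countable_rat by blast
  then obtain k where k: "strict_mono k"
    "\<And>q. q \<in> \<rat> \<inter> {0..} \<Longrightarrow> \<exists>l. (\<lambda>n. \<phi> (k n) q) \<longlonglongrightarrow> l"
    using function_convergent_subsequence[of _ \<phi> 1] \<phi> by metis
  have hk: "(\<lambda>n. h (k n)) \<longlonglongrightarrow> 0"
    using LIMSEQ_subseq_LIMSEQ[OF h0 k(1)] by (simp add: o_def)
  have conv_rat: "Cauchy (\<lambda>n. S (k n) q)" if q: "q \<in> \<rat> \<inter> {0..}" for q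
  proof -
    have nz: "norm z + K * (q + 1) + 1 \<noteq> 0"
      using pos[of q] q by simp
    obtain l where "(\<lambda>n. \<phi> (k n) q) \<longlonglongrightarrow> l" using k(2)[OF q] ..
    then have "(\<lambda>n. (norm z + K * (q + 1) + 1) *\<^sub>R \<phi> (k n) q) \<longlonglongrightarrow> (norm z + K * (q + 1) + 1) *\<^sub>R l"
      by (intro tendsto_scaleR tendsto_const)
    then show ?thesis
      using nz by (intro LIMSEQ_imp_Cauchy) (simp add: \<phi>_def)
  qed
  have "convergent (\<lambda>n. S (k n) t)" if t: "t \<ge> 0" for t
    unfolding Cauchy_convergent_iff[symmetric]
  proof (rule metric_CauchyI)
    fix \<epsilon> :: real assume \<epsilon>: "\<epsilon> > 0"
    \<comment> \<open>\<open>K\<close> may be 0, so \<open>K + 1\<close> serves as divisor. The 6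
      below splits \<epsilon> into three shares, each paying for a time distance and a rounding
      error of size \<open>d\<close>.\<close>
    define w where "w = K + 1"
    have w: "w > 0" "K \<le> w" using K by (auto simp: w_def)
    define d where "d = \<epsilon> / (6 * w)"
    have "d > 0" "w * (d + d) = \<epsilon> / 3" using w(1) \<epsilon> by (simp_all add: d_def)
    moreover from this(1) have "K * (d + d) \<le> w * (d + d)"
      using w(2) by (intro mult_right_mono) auto
    ultimately have d: "d > 0" "K * (d + d) \<le> \<epsilon> / 3" by linarith+
    obtain q where q: "q \<in> \<rat>" "t < q" "q < t + d"
      using Rats_dense_in_real[of t "t + d"] d by auto
    obtain N1 where N1: "\<And>m n. m \<ge> N1 \<Longrightarrow> n \<ge> N1 \<Longrightarrow> dist (S (k m) q) (S (k n) q) < \<epsilon> / 3"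
      using metric_CauchyD[OF conv_rat, of q "\<epsilon> / 3"] q t \<epsilon> by auto
    obtain N2 where N2: "\<And>n. n \<ge> N2 \<Longrightarrow> h (k n) < d"
      using order_tendstoD(2)[OF hk d(1)] by (auto simp: eventually_sequentially)
    have near: "dist (S (k n) t) (S (k n) q) \<le> \<epsilon> / 3" if "n \<ge> N2" for n
    proof -
      have "dist (S (k n) t) (S (k n) q) \<le> K * (\<bar>t - q\<bar> + h (k n))"
        using S_lip[of t q "k n"] q t by (simp add: dist_norm)
      also have "\<dots> \<le> K * (d + d)"
        using N2[OF that] q K by (intro mult_left_mono) auto
      finally show ?thesis using d by simp
    qed
    show "\<exists>M. \<forall>m\<ge>M. \<forall>n\<ge>M. dist (S (k m) t) (S (k n) t) < \<epsilon>"
    proof (intro exI[of _ "max N1 N2"] allI impI)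
      fix m n assume "m \<ge> max N1 N2" "n \<ge> max N1 N2"
      then show "dist (S (k m) t) (S (k n) t) < \<epsilon>"
        using near[of m] near[of n] N1[of m n]
          dist_triangle[of "S (k m) t" "S (k n) t" "S (k m) q"]
          dist_triangle[of "S (k m) q" "S (k n) t" "S (k n) q"]
        by (simp add: dist_commute)
    qed
  qed
  then obtain Z where Z: "\<And>t. t \<ge> 0 \<Longrightarrow> (\<lambda>n. S (k n) t) \<longlonglongrightarrow> Z t"
    unfolding convergent_def by metis
  \<comment> \<open>The reference time \<open>t\<close> may lie anywhere in the interval: as left or
    right endpoint it yields the two one-sided difference quotients.\<close>
  have Z_incr: "norm (Z b - Z a - (b - a) *\<^sub>R g) \<le> (b - a) * \<epsilon>"
    if ab: "0 \<le> a" "a \<le> b" and t: "t \<in> {a..b}" and r: "K * (b - a) < r"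
      and near: "\<And>x. norm (x - Z t) < r \<Longrightarrow> norm (G x - g) \<le> \<epsilon>" for a b t g \<epsilon> r
  proof -
    let ?l = "\<lambda>n. real (J (k n) b - J (k n) a) * h (k n)"
    have JJ: "(\<lambda>n. real (J (k n) t) * h (k n)) \<longlonglongrightarrow> t" if "t \<ge> 0" for t
    proof (rule tendsto_sandwich)
      show "(\<lambda>n. t - h (k n)) \<longlonglongrightarrow> t" using tendsto_diff[OF tendsto_const hk] by simp
    qed (use J_approx that in auto)
    have "(\<lambda>n. real (J (k n) b) * h (k n) - real (J (k n) a) * h (k n)) \<longlonglongrightarrow> b - a"
      using ab by (intro tendsto_diff JJ) auto
    then have l: "?l \<longlonglongrightarrow> b - a"
      using J_mono[OF ab(2)] by (simp add: of_nat_diff left_diff_distrib)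
    have "(\<lambda>n. K * (b - a + h (k n)) + norm (S (k n) t - Z t)) \<longlonglongrightarrow> K * (b - a + 0) + norm (Z t - Z t)"
      using ab t by (intro tendsto_intros hk Z) auto
    then have "\<forall>\<^sub>F n in sequentially. K * (b - a + h (k n)) + norm (S (k n) t - Z t) < r"
      by (rule order_tendstoD) (use r in simp)
    then have ev: "\<forall>\<^sub>F n in sequentially.
        norm (S (k n) b - S (k n) a - ?l n *\<^sub>R g) \<le> ?l n * \<epsilon>"
    proof eventually_elim
      case (elim n)
      have "norm (G (e (k n) i) - g) \<le> \<epsilon>" if "J (k n) a \<le> i" "i < J (k n) b" for i
      proof (rule near)
        have "norm (e (k n) i - Z t) \<le> norm (e (k n) i - S (k n) t) + norm (S (k n) t - Z t)"
          by (rule norm_triangle_sub[of "e (k n) i - Z t" "S (k n) t - Z t", simplified, THEN order_trans])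
             (simp add: add.commute)
        also have "\<dots> < r"
          using e_near[OF ab, of "k n" i t] that t elim by auto
        finally show "norm (e (k n) i - Z t) < r" .
      qed
      then show ?case
        using euler_increment_bound[of "h (k n)" "J (k n) a" "J (k n) b" G z g \<epsilon>]
          h(1)[of "k n"] J_mono[OF ab(2)]
        by (simp add: S_def e_def)
    qed
    show ?thesis
    proof (rule tendsto_le[OF sequentially_bot _ _ ev])
      show "(\<lambda>n. ?l n * \<epsilon>) \<longlonglongrightarrow> (b - a) * \<epsilon>"
        by (intro tendsto_intros l)
      show "(\<lambda>n. norm (S (k n) b - S (k n) a - ?l n *\<^sub>R g)) \<longlonglongrightarrow> norm (Z b - Z a - (b - a) *\<^sub>R g)"
        using ab by (intro tendsto_intros l Z) auto
    qed
  qed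
  have "ode_solution G {0..} Z"
    unfolding ode_solution_def has_vector_derivative_def has_derivative_within_alt
  proof (intro ballI conjI allI impI)
    fix t :: real assume t: "t \<in> {0..}"
    show "bounded_linear (\<lambda>x. x *\<^sub>R G (Z t))" by (rule bounded_linear_scaleR_left)
    fix \<epsilon> :: real assume "\<epsilon> > 0"
    then obtain r where r: "r > 0" "\<And>x. norm (x - Z t) < r \<Longrightarrow> norm (G x - G (Z t)) \<le> \<epsilon>"
      using cont unfolding continuous_on_iff dist_norm by (metis UNIV_I less_imp_le)
    define d where "d = r / (K + 1)"
    have d: "d > 0" "K * d < r" using K r(1) by (auto simp: d_def field_simps)
    show "\<exists>d>0. \<forall>u\<in>{0..}. norm (u - t) < d \<longrightarrow>
        norm (Z u - Z t - (u - t) *\<^sub>R G (Z t)) \<le> \<epsilon> * norm (u - t)"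
    proof (intro exI[of _ d] conjI ballI impI d)
      fix u :: real assume u: "u \<in> {0..}" "norm (u - t) < d"
      have "K * \<bar>u - t\<bar> \<le> K * d" using u K by (intro mult_left_mono) auto
      then have Kr: "K * \<bar>u - t\<bar> < r" using d by simp
      show "norm (Z u - Z t - (u - t) *\<^sub>R G (Z t)) \<le> \<epsilon> * norm (u - t)"
      proof (cases "t \<le> u")
        case True
        then show ?thesis
          using Z_incr[of t u t r "G (Z t)" \<epsilon>] t u Kr r(2) by (simp add: mult.commute)
      next
        case False
        have "norm (Z u - Z t - (u - t) *\<^sub>R G (Z t)) = norm (Z t - Z u - (t - u) *\<^sub>R G (Z t))"
          by (subst norm_minus_cancel[symmetric]) (simp add: algebra_simps)
        then show ?thesis
          using Z_incr[of u t t r "G (Z t)" \<epsilon>] t u Kr r(2) False by (simp add: mult.commute)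
      qed
    qed
  qed
  moreover have "Z 0 = z"
    using Z[of 0] by (simp add: S_0 LIMSEQ_const_iff)
  ultimately show ?thesis using that by blast
qed

section \<open>Stability by linearisation\<close>

text \<open>Gronwall's argument with a barrier: decay is known only below \<open>R\<close>, but up
  to a first time at which \<open>R\<close> is reached it would hold, forcing
  \<open>v \<le> v 0 < R\<close> at that very time.\<close>

lemma local_exponential_decay:
  fixes v :: "real \<Rightarrow> real"
  assumes deriv: "\<And>t. t \<in> {0..T} \<Longrightarrow> (v has_real_derivative v' t) (at t within {0..T})"
    and decay: "\<And>t. t \<in> {0..T} \<Longrightarrow> v t < R \<Longrightarrow> v' t \<le> - a * v t"
    and "a \<ge> 0" "v 0 \<ge> 0" "v 0 < R" "t \<in> {0..T}"
  shows "v t \<le> v 0 * exp (- a * t)"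
proof -
  have cont: "continuous_on {0..T} v"
    using deriv by (intro DERIV_continuous_on)
  \<comment> \<open>Only times strictly before \<open>t\<close> must lie below \<open>R\<close>, so
    that this applies to the first time at which \<open>R\<close> is reached.\<close>
  have upto: "v t \<le> v 0 * exp (- a * t)"
    if t: "t \<in> {0..T}" and below: "\<And>s. s \<in> {0..<t} \<Longrightarrow> v s < R" for t
  proof -
    let ?w = "\<lambda>s. v s * exp (a * s)"
    have "?w t \<le> ?w 0"
    proof (rule DERIV_nonpos_imp_decreasing_open[where f = ?w])
      show "0 \<le> t" using t by simp
      show "continuous_on {0..t} ?w"
        using t by (intro continuous_intros continuous_on_subset[OF cont]) auto
      fix s assume s: "0 < s" "s < t"
      have "(v has_real_derivative v' s) (at s)"
        using deriv[of s] s t by (simp add: at_within_Icc_at)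
      then have "(?w has_real_derivative (v' s + a * v s) * exp (a * s)) (at s)"
        by (auto intro!: derivative_eq_intros simp: algebra_simps)
      moreover have "(v' s + a * v s) * exp (a * s) \<le> 0"
        using decay[of s] below[of s] s t by (intro mult_nonpos_nonneg) auto
      ultimately show "\<exists>y. (?w has_real_derivative y) (at s) \<and> y \<le> 0" by blast
    qed
    then show ?thesis by (simp add: exp_minus field_simps)
  qed
  have "v s < R" if "s \<in> {0..T}" for s
  proof (rule ccontr)
    assume "\<not> v s < R"
    let ?S = "{s \<in> {0..T}. R \<le> v s}"
    have "closed ?S"
      using continuous_closed_preimage[OF cont closed_atLeastAtMost, of "{R..}"]
      by (simp add: vimage_def Int_def)
    then have "compact ?S"
      by (auto simp: compact_eq_bounded_closed intro: bounded_subset[OF bounded_closed_interval])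
    moreover have "?S \<noteq> {}" using that \<open>\<not> v s < R\<close> by auto
    ultimately have "\<exists>m\<in>?S. \<forall>s\<in>?S. m \<le> s"
      by (rule compact_attains_inf)
    then obtain m where m: "m \<in> ?S" "\<And>s. s \<in> ?S \<Longrightarrow> m \<le> s"
      by auto
    have "v m \<le> v 0 * exp (- a * m)"
    proof (rule upto)
      show "v s < R" if "s \<in> {0..<m}" for s
        using m(2)[of s] m(1) that by (cases "v s < R") auto
    qed (use m(1) in auto)
    also have "\<dots> \<le> v 0 * 1"
      using m assms by (intro mult_left_mono) auto
    finally show False using m assms by simp
  qed
  then show ?thesis using assms(6) by (intro upto) auto
qed

text \<open>Near \<open>e\<close> the linearisation error costs at most
  \<open>K * \<eta> = c/2\<close>, half of the available decay. As \<open>Q x x\<close> is at most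
  \<open>K\<close> times the squared norm, it decays at rate \<open>c/K\<close>; taking square roots
  gives the rate \<open>c / (2 * K)\<close> and the factor \<open>sqrt K\<close>.\<close>

lemma lyapunov_form_imp_exp_attractive:
  fixes G :: "'a::real_normed_vector \<Rightarrow> 'a"
  assumes Q: "lyapunov_form Q" and c: "c > 0" "\<And>x. Q x (A x) \<le> - c * (norm x)\<^sup>2"
    and G: "(G has_derivative A) (at e)" "G e = 0"
  shows "exp_attractive G e"
proof -
  interpret Q: bounded_bilinear Q using Q by (simp add: lyapunov_form_def)
  obtain K where K: "K > 0" "\<And>x y. norm (Q x y) \<le> norm x * norm y * K"
    using Q.pos_bounded by blast
  have Q_upper: "Q x x \<le> K * (norm x)\<^sup>2" for x
    using K(2)[of x x] by (simp add: power2_eq_square mult_ac)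
  define \<eta> where "\<eta> = c / (2 * K)"
  have \<eta>: "\<eta> > 0" "K * \<eta> = c / 2" using c K by (auto simp: \<eta>_def)
  obtain r where r: "r > 0"
    "\<And>z. norm (z - e) < r \<Longrightarrow> norm (G z - A (z - e)) \<le> \<eta> * norm (z - e)"
    using G \<eta>(1) unfolding has_derivative_at_alt by auto
  have near: "2 * Q (z - e) (G z) \<le> - (c / K) * Q (z - e) (z - e)" if "norm (z - e) < r" for z
  proof -
    let ?x = "z - e"
    have "Q ?x (G z) = Q ?x (A ?x) + Q ?x (G z - A ?x)"
      by (simp add: Q.diff_right)
    also have "Q ?x (G z - A ?x) \<le> norm ?x * norm (G z - A ?x) * K"
      using K(2)[of ?x "G z - A ?x"] by simp
    also have "\<dots> \<le> norm ?x * (\<eta> * norm ?x) * K"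
      using r(2)[OF that] K by (intro mult_right_mono mult_left_mono) auto
    also have "\<dots> = c / 2 * (norm ?x)\<^sup>2"
      using \<eta>(2) by (simp add: power2_eq_square mult_ac)
    finally have "2 * Q ?x (G z) \<le> - c * (norm ?x)\<^sup>2"
      using c(2)[of ?x] by simp
    also have "\<dots> \<le> - c * (Q ?x ?x / K)"
      using Q_upper[of ?x] K c by (intro mult_left_mono_neg) (auto simp: field_simps)
    finally show ?thesis by simp
  qed
  \<comment> \<open>This makes the initial value of \<open>Q\<close> at most
    \<open>K * \<delta>^2 < r^2\<close>; the level \<open>r^2\<close> works as barrier because
    \<open>Q\<close> dominates the squared norm. The summand 1 makes the inequality strict.\<close>
  define \<delta> where "\<delta> = r / sqrt (K + 1)"
  have \<delta>: "\<delta> > 0" using r K by (simp add: \<delta>_def)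
  have "norm (Z t - e) \<le> sqrt K * exp (- (c / (2 * K)) * t) * norm (Z 0 - e)"
    if Z: "ode_solution G {0..T} Z" and Z0: "norm (Z 0 - e) < \<delta>" and t: "t \<in> {0..T}" for T Z t
  proof -
    let ?v = "\<lambda>t. Q (Z t - e) (Z t - e)"
    have norm_le: "(norm (Z t - e))\<^sup>2 \<le> ?v t" for t
      using Q by (simp add: lyapunov_form_def)
    have "?v t \<le> ?v 0 * exp (- (c / K) * t)"
    proof (rule local_exponential_decay[where R = "r\<^sup>2" and T = T and v' = "\<lambda>t. 2 * Q (Z t - e) (G (Z t))"])
      fix s assume s: "s \<in> {0..T}"
      have "((\<lambda>t. Z t - e) has_vector_derivative G (Z s)) (at s within {0..T})"
        using Z s unfolding ode_solution_def by (auto intro!: derivative_eq_intros)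
      then have "(?v has_vector_derivative (Q (Z s - e) (G (Z s)) + Q (G (Z s)) (Z s - e))) (at s within {0..T})"
        by (intro Q.has_vector_derivative)
      moreover have "Q (G (Z s)) (Z s - e) = Q (Z s - e) (G (Z s))"
        using Q unfolding lyapunov_form_def by blast
      ultimately show "(?v has_real_derivative 2 * Q (Z s - e) (G (Z s))) (at s within {0..T})"
        by (simp add: has_real_derivative_iff_has_vector_derivative)
      assume "?v s < r\<^sup>2"
      then have "(norm (Z s - e))\<^sup>2 < r\<^sup>2" using norm_le[of s] by linarith
      then have "norm (Z s - e) < r" using r(1) power2_less_imp_less less_imp_le by blast
      then show "2 * Q (Z s - e) (G (Z s)) \<le> - (c / K) * ?v s" by (rule near)
    next
      show "c / K \<ge> 0" using c K by simp
      show "?v 0 \<ge> 0" using norm_le[of 0] by (meson order_trans zero_le_power2)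
      have "?v 0 \<le> K * (norm (Z 0 - e))\<^sup>2" by (rule Q_upper)
      also have "\<dots> \<le> K * \<delta>\<^sup>2" using Z0 K by (intro mult_left_mono power_mono) auto
      also have "\<dots> < r\<^sup>2" using r K by (simp add: \<delta>_def power_divide field_simps)
      finally show "?v 0 < r\<^sup>2" .
    qed (rule t)
    also have "\<dots> \<le> K * (norm (Z 0 - e))\<^sup>2 * exp (- (c / K) * t)"
      by (intro mult_right_mono Q_upper) auto
    also have "\<dots> = (sqrt K * exp (- (c / (2 * K)) * t) * norm (Z 0 - e))\<^sup>2"
      using K by (simp add: power_mult_distrib flip: exp_double)
    finally have "(norm (Z t - e))\<^sup>2 \<le> (sqrt K * exp (- (c / (2 * K)) * t) * norm (Z 0 - e))\<^sup>2"
      using norm_le[of t] by linarith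
    then show ?thesis
      using K by (intro power2_le_imp_le[of "norm (Z t - e)"]) auto
  qed
  then show ?thesis
    unfolding exp_attractive_def using \<delta> c K
    by (intro exI[of _ \<delta>] conjI exI[of _ "sqrt K"] exI[of _ "c / (2 * K)"]) auto
qed

lemma exp_attractive_imp_stable:
  assumes "exp_attractive G e"
  shows "stable G e"
  unfolding stable_def
proof (intro allI impI)
  fix \<epsilon> :: real assume \<epsilon>: "\<epsilon> > 0"
  obtain \<delta> M \<mu> where *: "\<delta> > 0" "M > 0" "\<mu> > 0"
    "\<forall>T\<ge>0. \<forall>Z. ode_solution G {0..T} Z \<and> norm (Z 0 - e) < \<delta> \<longrightarrow>
      (\<forall>t\<in>{0..T}. norm (Z t - e) \<le> M * exp (- \<mu> * t) * norm (Z 0 - e))"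
    using assms unfolding exp_attractive_def by blast
  show "\<exists>\<delta>>0. \<forall>T\<ge>0. \<forall>Z. ode_solution G {0..T} Z \<and> norm (Z 0 - e) < \<delta> \<longrightarrow>
      (\<forall>t\<in>{0..T}. norm (Z t - e) < \<epsilon>)"
  proof (intro exI[of _ "min \<delta> (\<epsilon> / M)"] conjI allI impI ballI)
    show "min \<delta> (\<epsilon> / M) > 0" using * \<epsilon> by simp
    fix T t :: real and Z
    assume T: "T \<ge> 0" "t \<in> {0..T}" and Z: "ode_solution G {0..T} Z \<and> norm (Z 0 - e) < min \<delta> (\<epsilon> / M)"
    have "norm (Z t - e) \<le> M * exp (- \<mu> * t) * norm (Z 0 - e)"
      using *(4)[rule_format, of T Z t] T Z by simp
    also have "\<dots> \<le> M * 1 * norm (Z 0 - e)"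
      using * T by (intro mult_right_mono mult_left_mono) auto
    also have "\<dots> < \<epsilon>" using * Z by (simp add: field_simps)
    finally show "norm (Z t - e) < \<epsilon>" .
  qed
qed

text \<open>
  Global solutions are first produced for the bounded field obtained by composing with the projection
  onto a ball around \<open>e\<close>. This field has the same linearisation, so its solutions near \<open>e\<close> never
  leave the ball, where both fields agree.
\<close>

theorem lyapunov_form_imp_exp_stable:
  fixes G :: "'a::euclidean_space \<Rightarrow> 'a"
  assumes cont: "continuous_on UNIV G" and G: "(G has_derivative A) (at e)" "G e = 0"
    and Q: "lyapunov_form Q" "c > 0" "\<And>x. Q x (A x) \<le> - c * (norm x)\<^sup>2"
  shows "exp_stable_equilibrium G e"
proof -
  have "exp_attractive G e" by (rule lyapunov_form_imp_exp_attractive[OF Q G])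
  define P where "P = closest_point (cball e 1)"
  have P_id: "P z = z" if "z \<in> cball e 1" for z
    using that by (simp add: P_def closest_point_self)
  have P_in: "P z \<in> cball e 1" for z
    unfolding P_def by (rule closest_point_in_set) auto
  let ?G = "\<lambda>z. G (P z)"
  have "continuous_on UNIV P"
    unfolding P_def by (rule continuous_on_closest_point) auto
  then have contP: "continuous_on UNIV ?G"
    by (rule continuous_on_compose2[OF cont]) auto
  have "compact (G ` cball e 1)"
    by (intro compact_continuous_image continuous_on_subset[OF cont]) auto
  then obtain K where K: "\<And>x. x \<in> G ` cball e 1 \<Longrightarrow> norm x \<le> K"
    using compact_imp_bounded bounded_iff by metis
  have "(?G has_derivative A) (at e)"
    by (rule has_derivative_transform_within_open[OF G(1), of "ball e 1"]) (auto simp: P_id)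
  then have "exp_attractive ?G e"
    using G(2) by (intro lyapunov_form_imp_exp_attractive[OF Q]) (auto simp: P_id)
  then have "stable ?G e" by (rule exp_attractive_imp_stable)
  then obtain \<delta> where \<delta>: "\<delta> > 0"
    "\<And>T Z t. T \<ge> 0 \<Longrightarrow> ode_solution ?G {0..T} Z \<Longrightarrow> norm (Z 0 - e) < \<delta> \<Longrightarrow> t \<in> {0..T} \<Longrightarrow>
      norm (Z t - e) < 1"
    unfolding stable_def by (metis zero_less_one)
  have "\<exists>Z. ode_solution G {0..} Z \<and> Z 0 = z" if z: "norm (z - e) < \<delta>" for z
  proof -
    obtain Z where Z: "ode_solution ?G {0..} Z" "Z 0 = z"
      using peano_existence_bounded[OF contP, of K] K P_in by blast
    have "norm (Z t - e) < 1" if "t \<ge> 0" for t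
    proof (rule \<delta>(2)[OF that])
      show "ode_solution ?G {0..t} Z"
        using Z(1) has_vector_derivative_within_subset[of Z _ _ "{0..}" "{0..t}"]
        unfolding ode_solution_def by fastforce
    qed (use z Z(2) that in auto)
    then have "P (Z t) = Z t" if "t \<ge> 0" for t
      using that by (intro P_id) (simp add: dist_norm norm_minus_commute less_imp_le)
    then have "ode_solution G {0..} Z"
      using Z(1) by (simp add: ode_solution_def)
    then show ?thesis using Z(2) by blast
  qed
  then have "forward_complete_near G e"
    unfolding forward_complete_near_def using \<delta>(1) by blast
  then show ?thesis
    unfolding exp_stable_equilibrium_def
    using G(2) \<open>exp_attractive G e\<close> exp_attractive_imp_stable by blast
qed

theorem hurwitz_imp_exp_stable:
  fixes G :: "real ^ 'k \<Rightarrow> real ^ ('k::finite)"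
  assumes "continuous_on UNIV G" "(G has_derivative (*v) A) (at e)" "G e = 0"
    and "\<And>\<mu>. \<mu> \<in> spectrum A \<Longrightarrow> Re \<mu> < 0"
  shows "exp_stable_equilibrium G e"
proof -
  obtain Q c where "lyapunov_form Q" "c > 0" "\<And>x. Q x (A *v x) \<le> - c * (norm x)\<^sup>2"
    using hurwitz_lyapunov_form[OF assms(4)] by blast
  then show ?thesis
    by (rule lyapunov_form_imp_exp_stable[OF assms(1-3)])
qed

section \<open>Gradients and Hessians at saddle points\<close>

lemma xpart_join [simp]: "xpart (join x y) = x"
  and ypart_join [simp]: "ypart (join x y) = y"
  by (simp_all add: xpart_def ypart_def join_def vec_eq_iff)

lemma join_parts [simp]: "join (xpart z) (ypart z) = z"
  by (auto simp: xpart_def ypart_def join_def vec_eq_iff split: sum.split)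

lemma parts_simps [simp]:
  "xpart 0 = 0" "xpart (z + w) = xpart z + xpart w" "xpart (z - w) = xpart z - xpart w"
  "xpart (- z) = - xpart z" "xpart (c *\<^sub>R z) = c *\<^sub>R xpart z"
  "ypart 0 = 0" "ypart (z + w) = ypart z + ypart w" "ypart (z - w) = ypart z - ypart w"
  "ypart (- z) = - ypart z" "ypart (c *\<^sub>R z) = c *\<^sub>R ypart z"
  by (simp_all add: xpart_def ypart_def vec_eq_iff)

lemma eq_parts_iff: "z = w \<longleftrightarrow> xpart z = xpart w \<and> ypart z = ypart w"
  by (metis join_parts)

lemma inner_parts: "z \<bullet> w = xpart z \<bullet> xpart w + ypart z \<bullet> ypart w"
  unfolding inner_vec_def xpart_def ypart_def UNIV_Plus_UNIV[symmetric]
  by (subst sum.Plus) simp_all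

lemma norm_parts: "(norm z)\<^sup>2 = (norm (xpart z))\<^sup>2 + (norm (ypart z))\<^sup>2"
  by (simp add: power2_norm_eq_inner inner_parts)

lemma Lam_mult: "Lam t *v z = join ((1 / t) *\<^sub>R xpart z) (ypart z)"
proof -
  have "(Lam t *v z) $ i = (case i of Inl a \<Rightarrow> 1 / t | Inr b \<Rightarrow> 1) * z $ i" for i
    unfolding matrix_vector_mult_def Lam_def
    by (simp add: if_distrib[of "\<lambda>x. x * _"] cong: if_cong)
  then show ?thesis
    by (simp add: vec_eq_iff join_def xpart_def ypart_def split: sum.split)
qed

lemma matrix_eqI: "(\<And>x. A *v x = B *v x) \<Longrightarrow> A = (B :: real ^ 'n ^ 'm)"
  by (simp add: matrix_eq)

lemma Lam_Lam: "Lam s ** Lam t = Lam (s * t)"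
  by (rule matrix_eqI) (simp add: Lam_mult flip: matrix_vector_mul_assoc)

section \<open>Second-order calculus and conditions at a local saddle\<close>

lemma GDERIV_grad:
  fixes f :: "'a::euclidean_space \<Rightarrow> real"
  assumes "f differentiable (at z)"
  shows "GDERIV f z :> grad f z"
proof -
  obtain f' where f': "(f has_derivative f') (at z)"
    using assms by (auto simp: differentiable_def)
  interpret f': bounded_linear f' using f' by (rule has_derivative_bounded_linear)
  have "f' h = h \<bullet> (\<Sum>b\<in>Basis. f' b *\<^sub>R b)" for h
  proof -
    have "f' h = f' (\<Sum>b\<in>Basis. (h \<bullet> b) *\<^sub>R b)" by (simp add: euclidean_representation)
    also have "\<dots> = h \<bullet> (\<Sum>b\<in>Basis. f' b *\<^sub>R b)"
      by (simp add: f'.sum f'.scaleR inner_sum_right mult.commute)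
    finally show ?thesis .
  qed
  then have "f' = (\<lambda>h. h \<bullet> (\<Sum>b\<in>Basis. f' b *\<^sub>R b))" by (rule ext)
  then have ex: "GDERIV f z :> (\<Sum>b\<in>Basis. f' b *\<^sub>R b)"
    using f' unfolding gderiv_def by metis
  have unique: "D = D'" if "GDERIV f z :> D" "GDERIV f z :> D'" for D D'
    using fun_cong[OF has_derivative_unique[OF that[unfolded gderiv_def]]] vector_eq_ldot[of D D']
    by blast
  have "grad f z = (\<Sum>b\<in>Basis. f' b *\<^sub>R b)"
    unfolding grad_def using ex unique[OF _ ex] by (rule the_equality)
  then show ?thesis using ex by simp
qed

lemma GDERIV_along_line:
  assumes "\<And>x. GDERIV f x :> g x"
  shows "((\<lambda>t. f (z + t *\<^sub>R u)) has_real_derivative g (z + t *\<^sub>R u) \<bullet> u) (at t)"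
proof -
  have "((\<lambda>t. z + t *\<^sub>R u) has_derivative (\<lambda>h. h *\<^sub>R u)) (at t)"
    by (auto intro!: derivative_eq_intros)
  from has_derivative_compose[OF this assms[unfolded gderiv_def]]
  show ?thesis
    by (simp add: has_field_derivative_def inner_commute mult.commute[of _ "_ \<bullet> _"])
qed

definition second_difference :: "('a::real_vector \<Rightarrow> real) \<Rightarrow> 'a \<Rightarrow> 'a \<Rightarrow> 'a \<Rightarrow> real \<Rightarrow> real" where
  "second_difference f z u w t = f (z + t *\<^sub>R u + t *\<^sub>R w) - f (z + t *\<^sub>R u) - f (z + t *\<^sub>R w) + f z"

text \<open>The second difference is the increment in direction \<open>u\<close> of the difference
  of \<open>f\<close> along two lines shifted by \<open>t w\<close>. The mean value theorem turns it
  into a difference of \<open>g\<close> at two points near \<open>z\<close>, which the derivative of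
  \<open>g\<close> at \<open>z\<close> expands.\<close>

lemma second_difference_approx:
  assumes f: "\<And>x. GDERIV f x :> g x" and g: "(g has_derivative D) (at z)" and "\<epsilon> > 0"
  shows "\<exists>d>0. \<forall>t. 0 < t \<and> t < d \<longrightarrow> \<bar>second_difference f z u w t - t\<^sup>2 * (D w \<bullet> u)\<bar> \<le> \<epsilon> * t\<^sup>2"
proof -
  interpret D: bounded_linear D using g by (rule has_derivative_bounded_linear)
  define N where "N = norm u + norm w + 1"
  have N: "N > 0" by (simp add: N_def add_nonneg_pos)
  \<comment> \<open>Both intermediate points lie within \<open>t * N\<close> of \<open>z\<close>, so
    the two errors sum to at most \<open>2 * \<eta> * t * N\<close>; the inner product with
    \<open>u\<close> and the outer factor \<open>t\<close> contribute the remaining \<open>N\<close>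
    and \<open>t\<close>.\<close>
  define \<eta> where "\<eta> = \<epsilon> / (2 * N\<^sup>2)"
  have \<eta>: "\<eta> > 0" "2 * \<eta> * N\<^sup>2 = \<epsilon>" using N \<open>\<epsilon> > 0\<close> by (auto simp: \<eta>_def)
  obtain r where r: "r > 0"
    "\<And>x. norm (x - z) < r \<Longrightarrow> norm (g x - g z - D (x - z)) \<le> \<eta> * norm (x - z)"
    using g \<eta>(1) unfolding has_derivative_at_alt by blast
  show ?thesis
  proof (intro exI[of _ "r / N"] conjI allI impI)
    show "r / N > 0" using r N by simp
    fix t assume t: "0 < t \<and> t < r / N"
    then have tN: "t * N < r" using N by (simp add: field_simps)
    let ?\<phi> = "\<lambda>\<xi>. f (z + t *\<^sub>R w + \<xi> *\<^sub>R u) - f (z + \<xi> *\<^sub>R u)"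
    let ?\<phi>' = "\<lambda>\<xi>. (g (z + t *\<^sub>R w + \<xi> *\<^sub>R u) - g (z + \<xi> *\<^sub>R u)) \<bullet> u"
    have "(?\<phi> has_real_derivative ?\<phi>' \<xi>) (at \<xi>)" for \<xi>
      unfolding inner_diff_left by (intro DERIV_diff GDERIV_along_line f)
    then obtain \<xi> where \<xi>: "0 < \<xi>" "\<xi> < t" "?\<phi> t - ?\<phi> 0 = (t - 0) * ?\<phi>' \<xi>"
      using MVT2[of 0 t ?\<phi> ?\<phi>'] t by blast
    let ?p = "t *\<^sub>R w + \<xi> *\<^sub>R u" and ?q = "\<xi> *\<^sub>R u"
    have p: "norm ?p \<le> t * N"
    proof -
      have "norm ?p \<le> t * norm w + \<xi> * norm u"
        using norm_triangle_ineq[of "t *\<^sub>R w" "\<xi> *\<^sub>R u"] t \<xi> by simp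
      also have "\<dots> \<le> t * norm w + t * norm u + t"
        using \<xi> t by (intro add_increasing2 add_left_mono mult_right_mono) auto
      finally show ?thesis by (simp add: N_def algebra_simps)
    qed
    have q: "norm ?q \<le> t * N"
    proof -
      have "norm ?q \<le> t * norm u" using \<xi> t by (simp add: mult_right_mono)
      also have "\<dots> \<le> t * N" using t by (intro mult_left_mono) (auto simp: N_def)
      finally show ?thesis .
    qed
    define e where "e = (g (z + ?p) - g z - D ?p) - (g (z + ?q) - g z - D ?q)"
    have "norm e \<le> \<eta> * norm ?p + \<eta> * norm ?q"
      unfolding e_def using r(2)[of "z + ?p"] r(2)[of "z + ?q"] p q tN
      by (intro order_trans[OF norm_triangle_ineq4 add_mono]) auto
    also have "\<dots> \<le> \<eta> * (t * N) + \<eta> * (t * N)"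
      using p q \<eta> by (intro add_mono mult_left_mono) auto
    finally have e: "norm e \<le> 2 * \<eta> * t * N" by (simp add: mult_ac)
    have "g (z + ?p) - g (z + ?q) = t *\<^sub>R D w + e"
      by (simp add: e_def D.add D.scaleR)
    then have "second_difference f z u w t = t * ((t *\<^sub>R D w + e) \<bullet> u)"
      using \<xi>(3) by (simp add: second_difference_def algebra_simps)
    then have "second_difference f z u w t - t\<^sup>2 * (D w \<bullet> u) = t * (e \<bullet> u)"
      by (simp add: inner_add_left power2_eq_square algebra_simps)
    also have "\<bar>\<dots>\<bar> \<le> t * (norm e * norm u)"
      using t Cauchy_Schwarz_ineq2[of e u] by (simp add: abs_mult)
    also have "\<dots> \<le> t * ((2 * \<eta> * t * N) * N)"
      using t e \<eta> N by (intro mult_left_mono mult_mono) (auto simp: N_def)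
    also have "\<dots> = \<epsilon> * t\<^sup>2"
      using \<eta>(2) by (simp add: power2_eq_square algebra_simps)
    finally show "\<bar>second_difference f z u w t - t\<^sup>2 * (D w \<bullet> u)\<bar> \<le> \<epsilon> * t\<^sup>2" .
  qed
qed

text \<open>The second difference is symmetric in \<open>u\<close> and \<open>w\<close>, so its two
  leading coefficients at \<open>t^2\<close> coincide.\<close>

lemma derivative_of_gradient_symmetric:
  assumes "\<And>x. GDERIV f x :> g x" and "(g has_derivative D) (at z)"
  shows "D u \<bullet> w = D w \<bullet> u"
proof -
  have "\<bar>D u \<bullet> w - D w \<bullet> u\<bar> \<le> 0 + \<epsilon>" if "\<epsilon> > 0" for \<epsilon>
  proof -
    have "\<epsilon> / 2 > 0" using that by simp
    from second_difference_approx[OF assms this, of u w] second_difference_approx[OF assms this, of w u]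
    obtain d1 d2 where d: "d1 > 0" "d2 > 0"
      "\<And>t. 0 < t \<Longrightarrow> t < d1 \<Longrightarrow> \<bar>second_difference f z u w t - t\<^sup>2 * (D w \<bullet> u)\<bar> \<le> \<epsilon> / 2 * t\<^sup>2"
      "\<And>t. 0 < t \<Longrightarrow> t < d2 \<Longrightarrow> \<bar>second_difference f z w u t - t\<^sup>2 * (D u \<bullet> w)\<bar> \<le> \<epsilon> / 2 * t\<^sup>2"
      by blast
    define t where "t = min d1 d2 / 2"
    have t: "0 < t" "t < d1" "t < d2" using d by (auto simp: t_def)
    have "second_difference f z u w t = second_difference f z w u t"
      by (simp add: second_difference_def add_ac)
    then have "\<bar>t\<^sup>2 * (D u \<bullet> w) - t\<^sup>2 * (D w \<bullet> u)\<bar> \<le> t\<^sup>2 * \<epsilon>"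
      using d(3)[OF t(1,2)] d(4)[OF t(1,3)] by (simp only: abs_le_iff) (simp add: mult.commute)
    then have "t\<^sup>2 * \<bar>D u \<bullet> w - D w \<bullet> u\<bar> \<le> t\<^sup>2 * \<epsilon>"
      by (simp flip: right_diff_distrib add: abs_mult)
    then show ?thesis using t by simp
  qed
  then have "\<bar>D u \<bullet> w - D w \<bullet> u\<bar> \<le> 0" by (rule field_le_epsilon)
  then show ?thesis by simp
qed

text \<open>If \<open>D u \<bullet> u\<close> were negative, the derivative along the line, which is
  0 at 0, would be negative just to the right, and \<open>f\<close> would fall below
  \<open>f z\<close>.\<close>

lemma local_min_along_line:
  assumes f: "\<And>x. GDERIV f x :> g x" and g: "(g has_derivative D) (at z)"
    and d: "d > 0" "\<And>t. \<bar>t\<bar> < d \<Longrightarrow> f z \<le> f (z + t *\<^sub>R u)"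
  shows "g z \<bullet> u = 0" "D u \<bullet> u \<ge> 0"
proof -
  interpret D: bounded_linear D using g by (rule has_derivative_bounded_linear)
  let ?\<phi> = "\<lambda>t. f (z + t *\<^sub>R u)" and ?\<phi>' = "\<lambda>t. g (z + t *\<^sub>R u) \<bullet> u"
  have \<phi>: "(?\<phi> has_real_derivative ?\<phi>' t) (at t)" for t
    by (rule GDERIV_along_line[OF f])
  have "?\<phi>' 0 = 0"
    using d by (intro DERIV_local_min[OF \<phi>, of d]) auto
  then show g0: "g z \<bullet> u = 0" by simp
  have line: "((\<lambda>t. z + t *\<^sub>R u) has_derivative (\<lambda>h. h *\<^sub>R u)) (at 0)"
    by (auto intro!: derivative_eq_intros)
  have "((\<lambda>t. g (z + t *\<^sub>R u)) has_derivative (\<lambda>h. D (h *\<^sub>R u))) (at 0)"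
    by (rule has_derivative_compose[OF line]) (use g in simp)
  then have "(?\<phi>' has_derivative (\<lambda>h. D (h *\<^sub>R u) \<bullet> u)) (at 0)"
    by (rule has_derivative_inner_left)
  moreover have "D (h *\<^sub>R u) = h *\<^sub>R D u" for h
    by (rule D.scaleR)
  ultimately have \<phi>'': "(?\<phi>' has_real_derivative D u \<bullet> u) (at 0)"
    by (simp add: has_field_derivative_def mult_commute_abs)
  show "D u \<bullet> u \<ge> 0"
  proof (rule ccontr)
    assume "\<not> D u \<bullet> u \<ge> 0"
    then obtain r where r: "r > 0" "\<And>h. 0 < h \<Longrightarrow> h < r \<Longrightarrow> ?\<phi>' h < 0"
      using DERIV_neg_dec_right[OF \<phi>''] g0 by auto
    define t where "t = min r d / 2"
    have t: "0 < t" "t < r" "t < d" using r d by (auto simp: t_def)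
    have "?\<phi> t < ?\<phi> 0"
    proof (rule DERIV_neg_imp_decreasing_open[OF t(1)])
      show "continuous_on {0..t} ?\<phi>"
        by (rule DERIV_continuous_on) (rule has_field_derivative_at_within[OF \<phi>])
      fix x assume "0 < x" "x < t"
      then show "\<exists>y. (?\<phi> has_real_derivative y) (at x) \<and> y < 0"
        using \<phi>[of x] r(2)[of x] t(2) by (intro exI[of _ "?\<phi>' x"]) auto
    qed
    then show False using d(2)[of t] t by simp
  qed
qed

text \<open>A line inside the x-block keeps the y-part of \<open>z\<close>, so \<open>f\<close> has
  a local minimum along it; inside the y-block the same holds for \<open>- f\<close>. The gradient
  is orthogonal to both of its own block components and therefore vanishes.\<close>

lemma saddle_point_derivatives:
  assumes f: "\<And>x. GDERIV f x :> g x" and g: "(g has_derivative D) (at z)" and "saddle_point f z"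
  shows "g z = 0"
    and "ypart u = 0 \<Longrightarrow> D u \<bullet> u \<ge> 0"
    and "xpart u = 0 \<Longrightarrow> D u \<bullet> u \<le> 0"
proof -
  obtain U where U: "open U" "z \<in> U"
    "\<And>x y. join x y \<in> U \<Longrightarrow> f (join (xpart z) y) \<le> f z \<and> f z \<le> f (join x (ypart z))"
    using assms(3) unfolding saddle_point_def by blast
  have line: "\<exists>d>0. \<forall>t. \<bar>t\<bar> < d \<longrightarrow> z + t *\<^sub>R u \<in> U" for u
  proof -
    obtain r where r: "r > 0" "ball z r \<subseteq> U" using U(1,2) openE by blast
    have "z + t *\<^sub>R u \<in> U" if "\<bar>t\<bar> < r / (norm u + 1)" for t
    proof -
      have "norm u + 1 > 0" by (simp add: add_nonneg_pos)
      then have "\<bar>t\<bar> * (norm u + 1) < r" using that by (simp add: field_simps)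
      then have "norm (t *\<^sub>R u) < r" by (simp add: algebra_simps)
      then show ?thesis using r(2) by (auto simp: dist_norm)
    qed
    moreover have "r / (norm u + 1) > 0" using r(1) by (simp add: add_nonneg_pos)
    ultimately show ?thesis by blast
  qed
  have x: "g z \<bullet> u = 0 \<and> D u \<bullet> u \<ge> 0" if u: "ypart u = 0" for u
  proof -
    obtain d where d: "d > 0" "\<And>t. \<bar>t\<bar> < d \<Longrightarrow> z + t *\<^sub>R u \<in> U" using line by blast
    have "f z \<le> f (z + t *\<^sub>R u)" if "\<bar>t\<bar> < d" for t
    proof -
      have "z + t *\<^sub>R u = join (xpart (z + t *\<^sub>R u)) (ypart z)"
        by (simp add: eq_parts_iff u)
      then show ?thesis using U(3) d(2)[OF that] by metis
    qed
    from local_min_along_line[OF f g d(1) this] show ?thesis by blast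
  qed
  have y: "g z \<bullet> u = 0 \<and> D u \<bullet> u \<le> 0" if u: "xpart u = 0" for u
  proof -
    obtain d where d: "d > 0" "\<And>t. \<bar>t\<bar> < d \<Longrightarrow> z + t *\<^sub>R u \<in> U" using line by blast
    have "- f z \<le> - f (z + t *\<^sub>R u)" if "\<bar>t\<bar> < d" for t
    proof -
      have "z + t *\<^sub>R u = join (xpart z) (ypart (z + t *\<^sub>R u))"
        by (simp add: eq_parts_iff u)
      then show ?thesis using U(3) d(2)[OF that] by (metis neg_le_iff_le)
    qed
    from local_min_along_line[OF GDERIV_minus[OF f] has_derivative_minus[OF g] d(1) this]
    show ?thesis by simp
  qed
  have "g z \<bullet> g z = g z \<bullet> join (xpart (g z)) 0 + g z \<bullet> join 0 (ypart (g z))"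
    by (simp add: inner_parts)
  also have "\<dots> = 0" using x[of "join (xpart (g z)) 0"] y[of "join 0 (ypart (g z))"] by simp
  finally show "g z = 0" by simp
  show "D u \<bullet> u \<ge> 0" if "ypart u = 0" using x that by blast
  show "D u \<bullet> u \<le> 0" if "xpart u = 0" using y that by blast
qed

lemma lipschitz_on_derivative_bound:
  assumes "L-lipschitz_on UNIV g" "(g has_derivative D) (at z)"
  shows "norm (D h) \<le> L * norm h"
proof (rule field_le_epsilon)
  interpret D: bounded_linear D using assms(2) by (rule has_derivative_bounded_linear)
  fix \<epsilon> :: real assume "\<epsilon> > 0"
  have h1: "norm h + 1 > 0" by (simp add: add_nonneg_pos)
  define \<eta> where "\<eta> = \<epsilon> / (norm h + 1)"
  have \<eta>: "\<eta> > 0" "\<eta> * norm h \<le> \<epsilon>"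
    using \<open>\<epsilon> > 0\<close> h1 by (auto simp: \<eta>_def field_simps)
  obtain r where r: "r > 0"
    "\<And>x. norm (x - z) < r \<Longrightarrow> norm (g x - g z - D (x - z)) \<le> \<eta> * norm (x - z)"
    using assms(2) \<eta>(1) unfolding has_derivative_at_alt by blast
  define w where "w = norm h + 1"
  have w: "w > 0" "norm h \<le> w" using h1 by (simp_all add: w_def)
  define t where "t = r / (2 * w)"
  have t: "t > 0" using r w by (simp add: t_def)
  have "t * norm h \<le> t * w" using t w by (intro mult_left_mono) auto
  also have "t * w < r" using r w by (simp add: t_def)
  finally have "t * norm h < r" .
  then have "norm (g (z + t *\<^sub>R h) - g z - D (t *\<^sub>R h)) \<le> \<eta> * (t * norm h)"
    using r(2)[of "z + t *\<^sub>R h"] t by simp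
  moreover have "norm (g (z + t *\<^sub>R h) - g z) \<le> L * (t * norm h)"
    using lipschitz_onD[OF assms(1), of "z + t *\<^sub>R h" z] t by (simp add: dist_norm)
  moreover have "D (t *\<^sub>R h) = t *\<^sub>R D h"
    by (rule D.scaleR)
  ultimately have "t * norm (D h) \<le> L * (t * norm h) + \<eta> * (t * norm h)"
    using norm_triangle_ineq4[of "g (z + t *\<^sub>R h) - g z" "g (z + t *\<^sub>R h) - g z - D (t *\<^sub>R h)"] t
    by simp
  also have "\<dots> = t * (L * norm h + \<eta> * norm h)" by (simp add: algebra_simps)
  finally have "norm (D h) \<le> L * norm h + \<eta> * norm h" using t by simp
  then show "norm (D h) \<le> L * norm h + \<epsilon>" using \<eta>(2) by simp
qed

text \<open>Write \<open>N x\<close> as \<open>N z + (N x - N z)\<close>. As \<open>g x\<close> is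
  of order \<open>norm (x - z)\<close> and \<open>N x - N z\<close> tends to 0, the second part
  contributes derivative 0.\<close>

lemma has_derivative_bilinear_vanishing_factor:
  assumes "bounded_bilinear bil" "isCont N z" "(g has_derivative g') (at z)" "g z = 0"
  shows "((\<lambda>x. bil (N x) (g x)) has_derivative (\<lambda>h. bil (N z) (g' h))) (at z)"
proof -
  interpret bil: bounded_bilinear bil by fact
  interpret g': bounded_linear g' using assms(3) by (rule has_derivative_bounded_linear)
  obtain K where K: "K > 0" "\<And>a b. norm (bil a b) \<le> norm a * norm b * K"
    using bil.pos_bounded by blast
  obtain C where C: "C > 0" "\<And>h. norm (g' h) \<le> norm h * C"
    using g'.pos_bounded by blast
  have "((\<lambda>x. bil (N x - N z) (g x)) has_derivative (\<lambda>h. 0)) (at z)"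
    unfolding has_derivative_at_alt
  proof (intro conjI allI impI)
    show "bounded_linear (\<lambda>h. 0)" by (rule bounded_linear_zero)
    fix \<epsilon> :: real assume \<epsilon>: "\<epsilon> > 0"
    define \<eta> where "\<eta> = \<epsilon> / ((C + 1) * K)"
    have \<eta>: "\<eta> > 0" "\<eta> * (C + 1) * K = \<epsilon>" using \<epsilon> K C by (auto simp: \<eta>_def)
    obtain d1 where d1: "d1 > 0" "\<And>x. norm (x - z) < d1 \<Longrightarrow> norm (g x - g z - g' (x - z)) \<le> 1 * norm (x - z)"
      using assms(3) zero_less_one unfolding has_derivative_at_alt by blast
    obtain d2 where d2: "d2 > 0" "\<And>x. norm (x - z) < d2 \<Longrightarrow> norm (N x - N z) < \<eta>"
      using assms(2) \<eta>(1) unfolding continuous_at_eps_delta dist_norm by blast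
    show "\<exists>d>0. \<forall>x. norm (x - z) < d \<longrightarrow>
        norm (bil (N x - N z) (g x) - bil (N z - N z) (g z) - 0) \<le> \<epsilon> * norm (x - z)"
    proof (intro exI[of _ "min d1 d2"] conjI allI impI)
      show "min d1 d2 > 0" using d1 d2 by simp
      fix x assume x: "norm (x - z) < min d1 d2"
      have "norm (g x) \<le> norm (g x - g' (x - z)) + norm (g' (x - z))"
        using norm_triangle_ineq[of "g x - g' (x - z)" "g' (x - z)"] by simp
      also have "\<dots> \<le> norm (x - z) * (C + 1)"
        using d1(2)[of x] C(2)[of "x - z"] x assms(4) by (simp add: algebra_simps)
      finally have gx: "norm (g x) \<le> norm (x - z) * (C + 1)" .
      have "norm (bil (N x - N z) (g x)) \<le> norm (N x - N z) * norm (g x) * K" by (rule K)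
      also have "\<dots> \<le> \<eta> * (norm (x - z) * (C + 1)) * K"
        using gx d2(2)[of x] x K \<eta> by (intro mult_right_mono mult_mono) auto
      also have "\<dots> = (\<eta> * (C + 1) * K) * norm (x - z)" by (simp only: mult_ac)
      finally show "norm (bil (N x - N z) (g x) - bil (N z - N z) (g z) - 0) \<le> \<epsilon> * norm (x - z)"
        by (simp only: \<eta>(2)) (simp add: bil.zero_left)
    qed
  qed
  moreover have "((\<lambda>x. bil (N z) (g x)) has_derivative (\<lambda>h. bil (N z) (g' h))) (at z)"
    by (rule bounded_linear.has_derivative[OF bil.bounded_linear_right assms(3)])
  ultimately have "((\<lambda>x. bil (N x - N z) (g x) + bil (N z) (g x)) has_derivative
      (\<lambda>h. 0 + bil (N z) (g' h))) (at z)"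
    by (rule has_derivative_add)
  then show ?thesis by (simp add: bil.diff_left)
qed

section \<open>Matrix forms of \<open>F\<close>, its Jacobian and the two fields\<close>

lemma bounded_bilinear_matrix_vector:
  "bounded_bilinear ((*v) :: real ^ 'n::finite ^ 'm::finite \<Rightarrow> _)"
  unfolding bilinear_conv_bounded_bilinear[symmetric] bilinear_def
  by (intro conjI allI linearI)
     (simp_all add: matrix_vector_mult_add_rdistrib matrix_vector_right_distrib
       matrix_vector_mult_scaleR flip: scaleR_matrix_vector_assoc)

lemma bounded_linear_matrix_mult_right: "bounded_linear ((**) (A :: real ^ 'n::finite ^ 'm::finite))"
  by (intro linear_conv_bounded_linear[THEN iffD1] linearI)
     (simp_all add: matrix_add_ldistrib matrix_scalar_ac scalar_matrix_assoc)


lemmas matrix_vector_minus =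
  bounded_bilinear.minus_left[OF bounded_bilinear_matrix_vector]
  bounded_bilinear.minus_right[OF bounded_bilinear_matrix_vector]

lemmas matrix_mult_minus_right = linear_neg[OF bounded_linear.linear[OF bounded_linear_matrix_mult_right]]

text \<open>\<open>Lam (- 1)\<close> is -1 on the x-block and 1 on the y-block, hence the sign flip
  in \<open>F\<close> up to an overall sign. By \<open>Lam_Lam\<close> it merges with
  \<open>Lam \<tau>\<close> into \<open>Lam (- \<tau>)\<close>.\<close>

lemma saddle_F_eq: "saddle_F f z = - (Lam (- 1) *v grad f z)"
  by (simp add: saddle_F_def Lam_mult eq_parts_iff)

lemma C2_grad_has_derivative:
  assumes "C2 f"
  shows "(grad f has_derivative (*v) (hessian f z)) (at z)"
  using assms by (simp add: C2_def hessian_def jacobian_works[symmetric])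

lemma jacobian_saddle_F:
  assumes "C2 f"
  shows "jacobian (saddle_F f) (at z) = - (Lam (- 1) ** hessian f z)"
proof -
  have "((\<lambda>z. Lam (- 1) *v grad f z) has_derivative (\<lambda>h. Lam (- 1) *v (hessian f z *v h))) (at z)"
    by (rule bounded_linear.has_derivative[OF matrix_vector_mul_bounded_linear C2_grad_has_derivative[OF assms]])
  from has_derivative_minus[OF this]
  have deriv: "(saddle_F f has_derivative (\<lambda>h. - (Lam (- 1) *v (hessian f z *v h)))) (at z)"
    unfolding saddle_F_eq .
  then have "saddle_F f differentiable (at z)" by (auto simp: differentiable_def)
  then have "(saddle_F f has_derivative (\<lambda>h. jacobian (saddle_F f) (at z) *v h)) (at z)"
    by (simp only: jacobian_works)
  from fun_cong[OF has_derivative_unique[OF this deriv]]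
  have "jacobian (saddle_F f) (at z) *v h = - (Lam (- 1) *v (hessian f z *v h))" for h .
  then show ?thesis
    by (intro matrix_eqI) (simp add: matrix_vector_mul_assoc matrix_vector_minus)
qed

lemma Lam_saddle_H:
  assumes "C2 f"
  shows "Lam \<tau> ** saddle_H f z = Lam (- \<tau>) ** hessian f z"
  by (simp add: saddle_H_def jacobian_saddle_F[OF assms] matrix_mul_assoc Lam_Lam)

lemma field_O1_eq: "field_O1 f \<tau> z = Lam (- \<tau>) *v grad f z"
proof -
  have "Lam \<tau> *v saddle_F f z = - (Lam \<tau> *v (Lam (- 1) *v grad f z))"
    by (simp add: saddle_F_eq Lam_mult eq_parts_iff)
  then show ?thesis
    by (simp add: field_O1_def matrix_vector_mul_assoc Lam_Lam)
qed

lemma field_Os_eq: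
  assumes "C2 f"
  shows "field_Os f \<tau> s z
    = (mat 1 + (s / 2) *\<^sub>R (Lam (- \<tau>) ** hessian f z)) *v (Lam (- \<tau>) *v grad f z)"
proof -
  have "Lam \<tau> *v saddle_F f z = - (Lam (- \<tau>) *v grad f z)"
    using field_O1_eq[of f \<tau> z] unfolding field_O1_def by (metis minus_minus)
  moreover have "Lam \<tau> ** jacobian (saddle_F f) (at z) = - (Lam (- \<tau>) ** hessian f z)"
    using Lam_saddle_H[OF assms, of \<tau> z] by (metis saddle_H_def matrix_mult_minus_right minus_minus)
  ultimately show ?thesis
    by (simp add: field_Os_def matrix_vector_mult_add_rdistrib
        matrix_vector_mult_diff_rdistrib matrix_vector_minus)
qed

section \<open>Eigenvalues at a saddle point and stability of the two fields\<close>

lemma saddle_eigenvalue: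
  fixes f :: "real ^ ('n::finite + 'm::finite) \<Rightarrow> real"
  assumes C2: "C2 f" and L: "L-lipschitz_on UNIV (grad f)" and inv: "invertible (hessian f z)"
    and \<tau>: "\<tau> > 0" and saddle: "saddle_point f z"
    and \<mu>: "\<mu> \<in> spectrum (Lam (- \<tau>) ** hessian f z)"
  shows "Re \<mu> \<le> 0" and "\<mu> \<noteq> 0" and "(Re \<mu>)\<^sup>2 + (Im \<mu>)\<^sup>2 \<le> max (L\<^sup>2) (L\<^sup>2 / \<tau>\<^sup>2)"
proof -
  define D where "D h = hessian f z *v h" for h
  define A where "A h = Lam (- \<tau>) *v D h" for h
  have deriv: "(grad f has_derivative D) (at z)"
    using C2_grad_has_derivative[OF C2] by (simp add: D_def[abs_def])
  have D_add: "D (u + w) = D u + D w" for u w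
    by (simp add: D_def matrix_vector_right_distrib)
  have gderiv: "GDERIV f x :> grad f x" for x
    using C2 by (intro GDERIV_grad) (simp add: C2_def)
  note symm = derivative_of_gradient_symmetric[OF gderiv deriv]
  note definite = saddle_point_derivatives(2,3)[OF gderiv deriv saddle]
  \<comment> \<open>Splitting \<open>h\<close> into its blocks, symmetry of \<open>D\<close> cancels
    the mixed terms and leaves the form of \<open>D\<close> on the x-block minus that on the
    y-block.\<close>
  have flip_nonneg: "xpart h \<bullet> xpart (D h) - ypart h \<bullet> ypart (D h) \<ge> 0" for h
  proof -
    define p q :: "real ^ ('n + 'm)" where "p = join (xpart h) 0" and "q = join 0 (ypart h)"
    have h: "h = p + q" by (simp add: p_def q_def eq_parts_iff)
    have "xpart h \<bullet> xpart (D h) - ypart h \<bullet> ypart (D h) = D h \<bullet> p - D h \<bullet> q"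
      by (simp add: p_def q_def inner_parts inner_commute)
    also have "\<dots> = D p \<bullet> p - D q \<bullet> q"
      using symm[of p q] by (simp add: h D_add inner_add_left)
    also have "\<dots> \<ge> 0"
      using definite(1)[of p] definite(2)[of q] by (simp add: p_def q_def)
    finally show ?thesis .
  qed
  have A_parts: "xpart (A h) = - ((1 / \<tau>) *\<^sub>R xpart (D h))" "ypart (A h) = ypart (D h)" for h
       by (simp_all add: A_def Lam_mult)
  \<comment> \<open>The weight \<tau> cancels the factor \<open>1 / \<tau>\<close> of
    \<open>Lam\<close>, so \<open>W h (A h)\<close> is minus the quantity in
    \<open>flip_nonneg\<close>.\<close>
  define W where "W h k = \<tau> * (xpart h \<bullet> xpart k) + ypart h \<bullet> ypart k"
    for h k :: "real ^ ('n + 'm)"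
  have W_A: "W h (A h) \<le> 0" for h
    using flip_nonneg[of h] \<tau> by (simp add: W_def A_parts)
  have W_pos: "W h h \<ge> 0" "h \<noteq> 0 \<Longrightarrow> W h h > 0" for h
    using \<tau> by (auto simp: W_def eq_parts_iff add_pos_nonneg add_nonneg_pos)
  define m where "m = max (L\<^sup>2) (L\<^sup>2 / \<tau>\<^sup>2)"
  \<comment> \<open>\<open>Lam (- \<tau>)\<close> scales the blocks by \<open>- 1 / \<tau>\<close>
    and 1, while \<open>L\<close> bounds \<open>D\<close>: this is where the maximum in the
    denominator of \<open>M_bound\<close> comes from.\<close>
  have A_bound: "(norm (A h))\<^sup>2 \<le> m * (norm h)\<^sup>2" for h
  proof -
    have "norm (D h) \<le> L * norm h"
      by (rule lipschitz_on_derivative_bound[OF L deriv])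
    then have "(norm (D h))\<^sup>2 \<le> L\<^sup>2 * (norm h)\<^sup>2"
      by (metis norm_ge_zero power_mono power_mult_distrib)
    moreover have "(norm (A h))\<^sup>2 \<le> max 1 (1 / \<tau>\<^sup>2) * (norm (D h))\<^sup>2"
    proof -
      have "(norm (A h))\<^sup>2 = 1 / \<tau>\<^sup>2 * (norm (xpart (D h)))\<^sup>2 + 1 * (norm (ypart (D h)))\<^sup>2"
        by (simp add: norm_parts[of "A h"] A_parts power_mult_distrib power_divide)
      also have "\<dots> \<le> max 1 (1 / \<tau>\<^sup>2) * (norm (xpart (D h)))\<^sup>2 + max 1 (1 / \<tau>\<^sup>2) * (norm (ypart (D h)))\<^sup>2"
        by (intro add_mono mult_right_mono) auto
      finally show ?thesis by (simp add: norm_parts[of "D h"] distrib_left)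
    qed
    ultimately have "(norm (A h))\<^sup>2 \<le> max 1 (1 / \<tau>\<^sup>2) * (L\<^sup>2 * (norm h)\<^sup>2)"
      by (meson le_max_iff_disj mult_left_mono order_trans zero_le_one)
    also have "max 1 (1 / \<tau>\<^sup>2) * (L\<^sup>2 * (norm h)\<^sup>2) = m * (norm h)\<^sup>2"
      by (simp add: m_def max_mult_distrib_right flip: mult.assoc)
    finally show ?thesis .
  qed
  obtain x y where xy: "x \<noteq> 0 \<or> y \<noteq> 0"
    "A x = Re \<mu> *\<^sub>R x - Im \<mu> *\<^sub>R y" "A y = Re \<mu> *\<^sub>R y + Im \<mu> *\<^sub>R x"
    using spectrum_real_pairs[OF \<mu>] unfolding A_def D_def matrix_vector_mul_assoc by metis
  \<comment> \<open>The two terms with \<open>Im \<mu>\<close> cancel because \<open>W\<close> is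
    symmetric.\<close>
  have "W x (A x) + W y (A y) = Re \<mu> * (W x x + W y y)"
    unfolding xy W_def by (simp add: inner_diff_right inner_add_right inner_commute algebra_simps)
  moreover have "W x x + W y y > 0"
    using xy(1) W_pos[of x] W_pos[of y] by (auto intro: add_pos_nonneg add_nonneg_pos)
  ultimately show "Re \<mu> \<le> 0"
    using W_A[of x] W_A[of y] by (smt (verit) zero_less_mult_iff)
  show "\<mu> \<noteq> 0"
  proof
    assume "\<mu> = 0"
    then have "A x = 0" "A y = 0" using xy by simp_all
    moreover have "h = 0" if "A h = 0" for h
    proof -
      have "D h = 0" using that \<tau> A_parts[of h] by (simp add: eq_parts_iff)
      then show ?thesis
        using inv invertible_left_inverse[of "hessian f z"] matrix_left_invertible_ker[of "hessian f z"]
        unfolding D_def by blast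
    qed
    ultimately show False using xy(1) by blast
  qed
  have "((Re \<mu>)\<^sup>2 + (Im \<mu>)\<^sup>2) * ((norm x)\<^sup>2 + (norm y)\<^sup>2) = (norm (A x))\<^sup>2 + (norm (A y))\<^sup>2"
    unfolding xy power2_norm_eq_inner
    by (simp add: inner_diff_left inner_diff_right inner_add_left inner_add_right inner_commute
        power2_eq_square algebra_simps)
  also have "\<dots> \<le> m * ((norm x)\<^sup>2 + (norm y)\<^sup>2)"
    using A_bound[of x] A_bound[of y] by (simp add: distrib_left)
  finally show "(Re \<mu>)\<^sup>2 + (Im \<mu>)\<^sup>2 \<le> max (L\<^sup>2) (L\<^sup>2 / \<tau>\<^sup>2)"
    unfolding m_def[symmetric]
    by (rule mult_right_le_imp_le) (use xy(1) in \<open>auto intro: add_pos_nonneg add_nonneg_pos\<close>)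
qed

lemma saddle_field_O1_exp_stable:
  fixes f :: "real ^ ('n::finite + 'm::finite) \<Rightarrow> real"
  assumes "C2 f" "saddle_point f z"
    and "\<And>\<mu>. \<mu> \<in> spectrum (Lam (- \<tau>) ** hessian f z) \<Longrightarrow> Re \<mu> < 0"
  shows "exp_stable_equilibrium (field_O1 f \<tau>) z"
proof (rule hurwitz_imp_exp_stable[OF _ _ _ assms(3)])
  have deriv: "(field_O1 f \<tau> has_derivative (*v) (Lam (- \<tau>) ** hessian f x)) (at x)" for x
    using bounded_linear.has_derivative[OF matrix_vector_mul_bounded_linear C2_grad_has_derivative[OF assms(1)]]
    unfolding field_O1_eq[abs_def] matrix_vector_mul_assoc .
  then show "(field_O1 f \<tau> has_derivative (*v) (Lam (- \<tau>) ** hessian f z)) (at z)" .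
  show "continuous_on UNIV (field_O1 f \<tau>)"
    by (intro continuous_at_imp_continuous_on ballI has_derivative_continuous[OF deriv])
  show "field_O1 f \<tau> z = 0"
    using saddle_point_derivatives(1)[OF GDERIV_grad C2_grad_has_derivative[OF assms(1)] assms(2)] assms(1)
    by (simp add: field_O1_eq C2_def)
qed

lemma saddle_field_Os_exp_stable:
  fixes f :: "real ^ ('n::finite + 'm::finite) \<Rightarrow> real"
  assumes C2: "C2 f" and "saddle_point f z" and "s \<noteq> 0"
    and hurwitz: "\<And>\<mu>. \<mu> \<in> spectrum (Lam (- \<tau>) ** hessian f z) \<Longrightarrow>
      Re \<mu> + s / 2 * ((Re \<mu>)\<^sup>2 - (Im \<mu>)\<^sup>2) < 0"
  shows "exp_stable_equilibrium (field_Os f \<tau> s) z"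
proof -
  define A where "A x = Lam (- \<tau>) ** hessian f x" for x
  define N where "N x = mat 1 + (s / 2) *\<^sub>R A x" for x
  define g where "g x = Lam (- \<tau>) *v grad f x" for x
  have field: "field_Os f \<tau> s = (\<lambda>x. N x *v g x)"
    by (simp add: fun_eq_iff field_Os_eq[OF C2] N_def A_def g_def)
  have g: "(g has_derivative (*v) (A x)) (at x)" for x
    using bounded_linear.has_derivative[OF matrix_vector_mul_bounded_linear C2_grad_has_derivative[OF C2]]
    unfolding g_def[abs_def] A_def matrix_vector_mul_assoc .
  have contN: "continuous_on UNIV N"
  proof -
    have "continuous_on UNIV (hessian f)" using C2 by (simp add: C2_def)
    then show ?thesis
      unfolding N_def[abs_def] A_def
      by (intro continuous_intros bounded_linear.continuous_on[OF bounded_linear_matrix_mult_right])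
  qed
  have contg: "continuous_on UNIV g"
    by (intro continuous_at_imp_continuous_on ballI has_derivative_continuous[OF g])
  have g0: "g z = 0"
    using saddle_point_derivatives(1)[OF GDERIV_grad C2_grad_has_derivative[OF C2] assms(2)] C2
    by (simp add: g_def C2_def)
  show ?thesis
  proof (rule hurwitz_imp_exp_stable)
    show "continuous_on UNIV (field_Os f \<tau> s)"
      unfolding field by (intro bounded_bilinear.continuous_on[OF bounded_bilinear_matrix_vector] contN contg)
    have "((\<lambda>x. N x *v g x) has_derivative (\<lambda>h. N z *v (A z *v h))) (at z)"
      using contN by (intro has_derivative_bilinear_vanishing_factor[OF bounded_bilinear_matrix_vector _ g g0])
        (simp add: continuous_on_eq_continuous_at)
    moreover have "N z *v (A z *v h) = (A z + (s / 2) *\<^sub>R (A z ** A z)) *v h" for h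
      by (simp add: N_def matrix_vector_mult_add_rdistrib
          flip: scaleR_matrix_vector_assoc matrix_vector_mul_assoc)
    ultimately show "(field_Os f \<tau> s has_derivative (*v) (A z + (s / 2) *\<^sub>R (A z ** A z))) (at z)"
      unfolding field by simp
    show "field_Os f \<tau> s z = 0" by (simp add: field g0)
    fix \<nu> assume "\<nu> \<in> spectrum (A z + (s / 2) *\<^sub>R (A z ** A z))"
    then obtain \<mu> where "\<mu> \<in> spectrum (A z)" "\<nu> = \<mu> + of_real (s / 2) * \<mu>\<^sup>2"
      using \<open>s \<noteq> 0\<close> by (elim spectrum_quadratic) auto
    then show "Re \<nu> < 0"
      using hurwitz[of \<mu>] by (simp add: A_def power2_eq_square)
  qed
qed

text \<open>Here \<open>a + i b\<close> is an eigenvalue and \<rho> the largest real part. If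
  \<open>\<rho> < 0\<close>, then \<open>s/2 * m < - \<rho> \<le> - a\<close>. Otherwise either
  \<open>a = 0\<close>, and \<open>b\<close> is nonzero so that \<open>- b^2\<close> decides, or
  \<open>a < 0\<close>, and \<open>a * (1 + s/2 * a)\<close> is negative because
  \<open>s/2 * |a| < 1\<close>.\<close>

lemma quadratic_shift_negative:
  fixes a b s m \<rho> :: real
  assumes "a \<le> 0" "a \<noteq> 0 \<or> b \<noteq> 0" "a\<^sup>2 + b\<^sup>2 \<le> m" "s > 0" "a \<le> \<rho>" "m > 0"
    and small: "(s / 2)\<^sup>2 * m < 1" and "\<rho> < 0 \<Longrightarrow> s / 2 < \<bar>\<rho>\<bar> / m"
  shows "a + s / 2 * (a\<^sup>2 - b\<^sup>2) < 0"
proof (cases "\<rho> < 0")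
  case True
  have "s / 2 * (a\<^sup>2 - b\<^sup>2) \<le> s / 2 * m"
    using assms(3,4) by (intro mult_left_mono) (auto intro: order_trans[of _ "a\<^sup>2 + b\<^sup>2"])
  also have "\<dots> < - \<rho>"
    using assms(8)[OF True] True \<open>m > 0\<close> by (simp add: field_simps)
  finally show ?thesis using assms(5) by simp
next
  case False
  show ?thesis
  proof (cases "a = 0")
    case True
    then show ?thesis using assms(2,4) by simp
  next
    case False
    have "(s / 2 * a)\<^sup>2 = (s / 2)\<^sup>2 * a\<^sup>2" by (simp add: power_mult_distrib power_divide)
    also have "\<dots> \<le> (s / 2)\<^sup>2 * m"
      using assms(3) by (intro mult_left_mono) (auto intro: order_trans[of _ "a\<^sup>2 + b\<^sup>2"])
    also have "\<dots> < 1" by (rule small)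
    finally have "\<bar>s / 2 * a\<bar> < 1" by (simp add: abs_square_less_1)
    then have "0 < 1 + s / 2 * a" by (simp add: abs_less_iff)
    then have "a * (1 + s / 2 * a) < 0" using False assms(1) by (simp add: mult_neg_pos)
    then have "a + s / 2 * a\<^sup>2 < 0" by (simp add: power2_eq_square algebra_simps)
    moreover have "s / 2 * b\<^sup>2 \<ge> 0" using assms(4) by simp
    ultimately show ?thesis by (simp add: right_diff_distrib)
  qed
qed

theorem theorem4p9:
  fixes f :: "real ^ ('n::finite + 'm::finite) \<Rightarrow> real" and L \<tau> :: real
  assumes "C2 f"
    and "L > 0" and "L-lipschitz_on UNIV (grad f)"
    and "\<And>zs. saddle_point f zs \<Longrightarrow> invertible (hessian f zs)"
    and "\<tau> > 0"
  shows "((\<forall>zs. saddle_point f zs \<longrightarrow> (\<forall>\<mu>\<in>spectrum (Lam \<tau> ** saddle_H f zs). Re \<mu> \<noteq> 0)) \<longrightarrow>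
           {zs. saddle_point f zs} \<subseteq> {z. exp_stable_equilibrium (field_O1 f \<tau>) z})
       \<and> (\<forall>s::real.
           (\<forall>zs. saddle_point f zs \<longrightarrow>
              0 < s \<and> ereal s < 2 * min (M_bound f L \<tau> zs) (ereal (min (1 / L) (\<tau> / L)))) \<longrightarrow>
           {zs. saddle_point f zs} \<subseteq> {z. exp_stable_equilibrium (field_Os f \<tau> s) z})"
proof (intro conjI allI impI subsetI CollectI)
  fix z
  assume nz: "\<forall>zs. saddle_point f zs \<longrightarrow> (\<forall>\<mu>\<in>spectrum (Lam \<tau> ** saddle_H f zs). Re \<mu> \<noteq> 0)"
    and "z \<in> {zs. saddle_point f zs}"
  then have z: "saddle_point f z" by simp
  have "Re \<mu> < 0" if "\<mu> \<in> spectrum (Lam (- \<tau>) ** hessian f z)" for \<mu>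
    using saddle_eigenvalue(1)[OF assms(1,3) assms(4)[OF z] assms(5) z that] nz z that
    unfolding Lam_saddle_H[OF assms(1)] by fastforce
  then show "exp_stable_equilibrium (field_O1 f \<tau>) z"
    by (rule saddle_field_O1_exp_stable[OF assms(1) z])
next
  fix s z
  assume s: "\<forall>zs. saddle_point f zs \<longrightarrow>
      0 < s \<and> ereal s < 2 * min (M_bound f L \<tau> zs) (ereal (min (1 / L) (\<tau> / L)))"
    and "z \<in> {zs. saddle_point f zs}"
  then have z: "saddle_point f z" by simp
  define \<rho> where "\<rho> = max_Re (Lam (- \<tau>) ** hessian f z)"
  define m where "m = max (L\<^sup>2) (L\<^sup>2 / \<tau>\<^sup>2)"
  have s0: "s > 0" and bound: "ereal s < 2 * min (M_bound f L \<tau> z) (ereal (min (1 / L) (\<tau> / L)))"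
    using s z by auto
  have M: "M_bound f L \<tau> z = (if \<rho> < 0 then ereal (\<bar>\<rho>\<bar> / m) else \<infinity>)"
    by (simp add: M_bound_def Lam_saddle_H[OF assms(1)] \<rho>_def m_def)
  have two: "(2::ereal) * ereal r = ereal (2 * r)" for r
    by (metis numeral_eq_ereal times_ereal.simps(1))
  \<comment> \<open>For \<open>\<rho> \<ge> 0\<close> the first entry is infinite and imposes
    nothing on \<open>s\<close>, hence the implication.\<close>
  have min_bounds: "s / 2 < p \<and> s / 2 < q \<and> (\<rho> < 0 \<longrightarrow> s / 2 < r)"
    if "ereal s < 2 * min (if \<rho> < 0 then ereal r else \<infinity>) (ereal (min p q))" for p q r
    using that by (auto simp: two min_def split: if_splits)
  have small: "s / 2 < 1 / L" "s / 2 < \<tau> / L" and M': "\<rho> < 0 \<Longrightarrow> s / 2 < \<bar>\<rho>\<bar> / m"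
    using min_bounds[OF bound[unfolded M]] by blast+
  \<comment> \<open>Squared, the two left sides are \<open>(s/2)^2\<close> times the two entries of
    the maximum \<open>m\<close>.\<close>
  have "s / 2 * L < 1" "s / 2 * (L / \<tau>) < 1"
    using small assms(2,5) by (simp_all add: field_simps)
  then have "(s / 2 * L)\<^sup>2 < 1" "(s / 2 * (L / \<tau>))\<^sup>2 < 1"
    using s0 assms(2,5) by (auto simp: power_less_one_iff)
  then have m1: "(s / 2)\<^sup>2 * m < 1"
    by (simp add: m_def max_def power_mult_distrib power_divide)
  have m0: "m > 0" using assms(2) by (simp add: m_def less_max_iff_disj)
  show "exp_stable_equilibrium (field_Os f \<tau> s) z"
  proof (rule saddle_field_Os_exp_stable[OF assms(1) z])
    show "s \<noteq> 0" using s0 by simp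
    fix \<mu> assume \<mu>: "\<mu> \<in> spectrum (Lam (- \<tau>) ** hessian f z)"
    note ev = saddle_eigenvalue[OF assms(1,3) assms(4)[OF z] assms(5) z \<mu>]
    show "Re \<mu> + s / 2 * ((Re \<mu>)\<^sup>2 - (Im \<mu>)\<^sup>2) < 0"
      using ev Re_le_max_Re[OF \<mu>] s0 m0 m1 M'
      by (intro quadratic_shift_negative[where m = m and \<rho> = \<rho>]) (auto simp: complex_eq_iff \<rho>_def m_def)
  qed
qed

end
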